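(* Let $\sigma = \sigma_{i_1}\circ\cdots\circ\sigma_{i_n}$ (with $n \geq 1$ and $i_1,\ldots,i_n \in \{1,2,3\}$) be a finite product of the three-letter Arnoux-Rauzy substitutions $\sigma_1,\sigma_2,\sigma_3$, and suppose that $\sigma$ is Pisot irreducible. Then the Rauzy fractal of $\sigma$ is connected.
   Context: Substitutions. Let $\mathcal A=\{1,2,3\}$ and let $\mathcal A^\star$ be the set of finite words over $\mathcal A$. A substitution is a map $\sigma:\mathcal A^\star\to\mathcal A^\star$ with $\sigma(uv)=\sigma(u)\sigma(v)$ for all words $u,v$ and such that the image of each letter is not the empty word. Its incidence matrix is $\mathbf M_\sigma=(m_{ij})_{1\le i,j\le 3}$, where $m_{ij}$ is the number of occurrences of the letter $i$ in $\sigma(j)$. The substitution is unimodular if $\det \mathbf M_\sigma=\pm1$. The Arnoux-Rauzy substitutions are $\sigma_1: 1\mapsto 1,\ 2\mapsto 21,\ 3\mapsto 31$; $\sigma_2: 1\mapsto 12,\ 2\mapsto 2,\ 3\mapsto 32$; $\sigma_3: 1\mapsto 13,\ 2\mapsto 23,\ 3\mapsto 3$. They are unimodular, and so is every finite product of them. A Pisot number is a real algebraic integer greater than $1$ all of whose other conjugates have absolute value less than $1$. A unimodular substitution $\sigma$ is Pisot irreducible if the maximal eigenvalue of $\mathbf M_\sigma$ is a Pisot number and the characteristic polynomial of $\mathbf M_\sigma$ is irreducible (over $\mathbb Q$). Unit faces. Let $(\mathbf e_1,\mathbf e_2,\mathbf e_3)$ be the canonical basis of $\mathbb R^3$. For $\mathbf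 x\in\mathbb Z^3$ and $i\in\{1,2,3\}$, the unit face of type $i$ at $\mathbf x$ is $[\mathbf x,i]^\star=\{\mathbf x+\lambda \mathbf e_j+\mu \mathbf e_k:\lambda,\mu\in[0,1]\}$, where $\{i,j,k\}=\{1,2,3\}$. Let $\mathcal U=[\mathbf 0,1]^\star\cup[\mathbf 0,2]^\star\cup[\mathbf 0,3]^\star$. Dual substitution. Let $\mathbf P(w)=(|w|_1,|w|_2,|w|_3)$, where $|w|_i$ is the number of occurrences of $i$ in $w$. For a unimodular substitution $\sigma$, the dual substitution $\mathbf E_1^*(\sigma)$ is defined on unit faces by $$\mathbf E_1^*(\sigma)([\mathbf x,i]^\star)=\bigcup_{j=1,2,3}\ \bigcup_{(p,s)\in\mathcal A^\star\times\mathcal A^\star:\ \sigma(j)=pis}[\mathbf M_\sigma^{-1}(\mathbf x+\mathbf P(s)),j]^\star$$ and extended to unions of unit faces by taking the union of the images of the faces. $\mathbf E_1^*(\sigma)^n$ denotes the $n$-th iterate. Contracting plane and Rauzy fractal. Let $\sigma$ be unimodular Pisot irreducible with maximal eigenvalue $\beta$. Let $\mathbf u_\beta$ be an eigenvector with $\mathbf M_\sigma\mathbf u_\beta=\beta\mathbf u_\beta$, and let $\mathbf v_\beta$ be an eigenvector with positive entries with ${}^{t}\mathbf M_\sigma\mathbf v_\beta=\beta\mathbf v_\beta$. The contracting plane $\mathbb P_{\mathrm c}$ is $\{\mathbf x\in\mathbb R^3:\langle\mathbf x,\mathbf v_\beta\rangle=0\}$, and $\pi_{\mathrm c}:\mathbb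 R^3\to\mathbb P_{\mathrm c}$ is the linear projection onto $\mathbb P_{\mathrm c}$ along $\mathbf u_\beta$. For $n\ge 0$ let $$\mathcal D_n=\mathbf M_\sigma^n\big(\pi_{\mathrm c}(\mathbf E_1^*(\sigma)^n(\mathcal U))\big)\subset\mathbb P_{\mathrm c}.$$ The sequence $(\mathcal D_n)_{n\ge 0}$ converges in the space of compact subsets of $\mathbb P_{\mathrm c}$ with the Hausdorff distance (a known result of Arnoux and Ito), and the Rauzy fractal of $\sigma$ is its Hausdorff limit. *)

theory Defs
  imports
    "HOL-Analysis.Analysis"
    "HOL-Computational_Algebra.Polynomial_Factorial"
begin

section \<open>Substitutions over three letters\<close>

text \<open>The alphabet is the three-element type \<^typ>\<open>3\<close>, with elements \<open>1\<close>, \<open>2\<close>, \<open>3\<close> (where \<open>3 = 0\<close>);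
  it also indexes the coordinates of vectors and matrices.\<close>

type_synonym letter = 3
type_synonym word = "letter list"

definition substitution :: "(word \<Rightarrow> word) \<Rightarrow> bool" where
  "substitution \<sigma> \<longleftrightarrow> (\<forall>u v. \<sigma> (u @ v) = \<sigma> u @ \<sigma> v) \<and> (\<forall>a. \<sigma> [a] \<noteq> [])"

text \<open>The following two notions are polymorphic in the coefficients, because they are used over
  the integers, the rationals, the reals and the complex numbers.\<close>

definition abelianization :: "word \<Rightarrow> 'a::semiring_1 ^ letter" where
  "abelianization w = (\<chi> i. of_nat (count_list w i))"

definition incidence_matrix :: "(word \<Rightarrow> word) \<Rightarrow> 'a::semiring_1 ^ letter ^ letter" where
  "incidence_matrix \<sigma> = (\<chi> i j. of_nat (count_list (\<sigma> [j]) i))"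

definition unimodular :: "(word \<Rightarrow> word) \<Rightarrow> bool" where
  "unimodular \<sigma> \<longleftrightarrow> \<bar>det (incidence_matrix \<sigma> :: int ^ letter ^ letter)\<bar> = 1"

definition arnoux_rauzy :: "letter \<Rightarrow> word \<Rightarrow> word" where
  "arnoux_rauzy i w = concat (map (\<lambda>j. if j = i then [i] else [j, i]) w)"

lemma arnoux_rauzy_letters:
  "arnoux_rauzy 1 [1] = [1]" "arnoux_rauzy 1 [2] = [2, 1]" "arnoux_rauzy 1 [3] = [3, 1]"
  "arnoux_rauzy 2 [1] = [1, 2]" "arnoux_rauzy 2 [2] = [2]" "arnoux_rauzy 2 [3] = [3, 2]"
  "arnoux_rauzy 3 [1] = [1, 3]" "arnoux_rauzy 3 [2] = [2, 3]" "arnoux_rauzy 3 [3] = [3]"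
  by (simp_all add: arnoux_rauzy_def)

definition arnoux_rauzy_product :: "letter list \<Rightarrow> word \<Rightarrow> word" where
  "arnoux_rauzy_product ks = foldr (\<circ>) (map arnoux_rauzy ks) id"

section \<open>Pisot irreducible substitutions\<close>

definition conjugate_over_rat :: "complex \<Rightarrow> complex \<Rightarrow> bool" where
  "conjugate_over_rat x y \<longleftrightarrow>
     (\<exists>p :: rat poly. irreducible p \<and> poly (map_poly of_rat p) x = 0 \<and> poly (map_poly of_rat p) y = 0)"

definition pisot_number :: "real \<Rightarrow> bool" where
  "pisot_number \<beta> \<longleftrightarrow> algebraic_int \<beta> \<and> \<beta> > 1 \<and>
     (\<forall>z. conjugate_over_rat (of_real \<beta>) z \<and> z \<noteq> of_real \<beta> \<longrightarrow> cmod z < 1)"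

definition eigenvector :: "'a::field ^ 'n ^ 'n \<Rightarrow> 'a \<Rightarrow> 'a ^ 'n \<Rightarrow> bool" where
  "eigenvector A c x \<longleftrightarrow> x \<noteq> 0 \<and> A *v x = c *s x"

definition eigenvalue :: "'a::field ^ 'n ^ 'n \<Rightarrow> 'a \<Rightarrow> bool" where
  "eigenvalue A c \<longleftrightarrow> (\<exists>x. eigenvector A c x)"

text \<open>Such a \<open>\<beta>\<close> is non-negative, hence it is unique; for non-negative matrices it exists by the
  Perron-Frobenius theorem.\<close>

definition maximal_eigenvalue :: "(word \<Rightarrow> word) \<Rightarrow> real \<Rightarrow> bool" where
  "maximal_eigenvalue \<sigma> \<beta> \<longleftrightarrow>
     eigenvalue (incidence_matrix \<sigma> :: complex ^ letter ^ letter) (of_real \<beta>) \<and>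
     (\<forall>c. eigenvalue (incidence_matrix \<sigma> :: complex ^ letter ^ letter) c \<longrightarrow> cmod c \<le> \<beta>)"

definition characteristic_poly :: "'a::comm_ring_1 ^ 'n ^ 'n \<Rightarrow> 'a poly" where
  "characteristic_poly A = det (mat [:0, 1:] - (\<chi> i j. [:A $ i $ j:]))"

definition pisot_irreducible :: "(word \<Rightarrow> word) \<Rightarrow> bool" where
  "pisot_irreducible \<sigma> \<longleftrightarrow> substitution \<sigma> \<and> unimodular \<sigma> \<and>
     (\<exists>\<beta>. maximal_eigenvalue \<sigma> \<beta> \<and> pisot_number \<beta>) \<and>
     irreducible (characteristic_poly (incidence_matrix \<sigma> :: rat ^ letter ^ letter))"

section \<open>Unit faces and dual substitutions\<close>

text \<open>A pair \<open>(x, i)\<close> names the unit face of type \<open>i\<close> at \<open>x\<close>; distinct pairs name distinct faces, and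
  a unit face contained in a union of unit faces is one of them. A union of unit faces is therefore
  represented by the set of the names of its faces, on which the dual substitution acts;
  \<open>faces_union\<close> returns the subset of space that is named.\<close>

type_synonym face = "(int ^ letter) \<times> letter"

definition unit_face :: "face \<Rightarrow> (real ^ letter) set" where
  "unit_face = (\<lambda>(x, i). {(\<chi> l. real_of_int (x $ l)) + a *\<^sub>R axis j 1 + b *\<^sub>R axis k 1 | a b j k.
     a \<in> {0..1} \<and> b \<in> {0..1} \<and> {i, j, k} = UNIV})"

definition faces_union :: "face set \<Rightarrow> (real ^ letter) set" where
  "faces_union X = (\<Union>f\<in>X. unit_face f)"

definition corner :: "face set" where
  "corner = {(0, 1), (0, 2), (0, 3)}"

definition dual_subst_face :: "(word \<Rightarrow> word) \<Rightarrow> face \<Rightarrow> face set" where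
  "dual_subst_face \<sigma> = (\<lambda>(x, i).
     {(matrix_inv (incidence_matrix \<sigma>) *v (x + abelianization s), j) | j p s. \<sigma> [j] = p @ [i] @ s})"

definition dual_subst :: "(word \<Rightarrow> word) \<Rightarrow> face set \<Rightarrow> face set" where
  "dual_subst \<sigma> X = (\<Union>f\<in>X. dual_subst_face \<sigma> f)"

section \<open>Rauzy fractals\<close>

text \<open>Below, \<open>u\<close> and \<open>v\<close> stand for a right and a left eigenvector for the maximal eigenvalue.\<close>

definition contracting_plane :: "real ^ letter \<Rightarrow> (real ^ letter) set" where
  "contracting_plane v = {x. x \<bullet> v = 0}"

definition contracting_projection :: "real ^ letter \<Rightarrow> real ^ letter \<Rightarrow> real ^ letter \<Rightarrow> real ^ letter" where
  "contracting_projection u v x = x - ((x \<bullet> v) / (u \<bullet> v)) *\<^sub>R u"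

lemma contracting_projection:
  assumes "u \<bullet> v \<noteq> 0"
  shows "linear (contracting_projection u v)"
    and "contracting_projection u v x \<in> contracting_plane v"
    and "y \<in> contracting_plane v \<Longrightarrow> contracting_projection u v y = y"
    and "contracting_projection u v u = 0"
  using assms
  by (auto simp: contracting_projection_def contracting_plane_def inner_diff_left
      inner_add_left add_divide_distrib algebra_simps intro!: linearI)

definition rauzy_approx ::
    "(word \<Rightarrow> word) \<Rightarrow> real ^ letter \<Rightarrow> real ^ letter \<Rightarrow> nat \<Rightarrow> (real ^ letter) set" where
  "rauzy_approx \<sigma> u v n =
     ((*v) (incidence_matrix \<sigma>) ^^ n) `
       contracting_projection u v ` faces_union ((dual_subst \<sigma> ^^ n) corner)"

text \<open>This is the Hausdorff distance when \<open>A\<close> and \<open>B\<close> are bounded and non-empty.\<close>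

definition hausdorff_distance :: "'a::metric_space set \<Rightarrow> 'a set \<Rightarrow> real" where
  "hausdorff_distance A B = max (SUP a\<in>A. infdist a B) (SUP b\<in>B. infdist b A)"

definition rauzy_fractal ::
    "(word \<Rightarrow> word) \<Rightarrow> real ^ letter \<Rightarrow> real ^ letter \<Rightarrow> (real ^ letter) set" where
  "rauzy_fractal \<sigma> u v =
     (THE R. compact R \<and> R \<noteq> {} \<and> R \<subseteq> contracting_plane v \<and>
       (\<lambda>n. hausdorff_distance (rauzy_approx \<sigma> u v n) R) \<longlonglongrightarrow> 0)"

end

theory Submission
  imports Defs "HOL-Computational_Algebra.Field_as_Ring"
begin

text \<open>
  The Rauzy fractal is the Hausdorff limit of the sets
  \<open>D\<^sub>n = M\<^sup>n \<pi> (E\<^sub>1\<^sup>*(\<sigma>)\<^sup>n \<U>)\<close>, so it is connected as soon as the limit exists and each \<open>D\<^sub>n\<close>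
  is connected; since \<open>M\<^sup>n \<pi>\<close> is continuous, it is enough that the union of the faces in
  \<open>E\<^sub>1\<^sup>*(\<sigma>)\<^sup>n \<U>\<close> is connected.

  Connectedness of the unions of faces. Since \<open>E\<^sub>1\<^sup>*(\<sigma> \<circ> \<tau>) = E\<^sub>1\<^sup>*(\<tau>) \<circ> E\<^sub>1\<^sup>*(\<sigma>)\<close>
  (\<open>dual_subst_comp\<close>), these sets of faces arise from the corner \<open>\<U>\<close> by applying duals of
  \<open>\<sigma>\<^sub>1\<close>, \<open>\<sigma>\<^sub>2\<close>, \<open>\<sigma>\<^sub>3\<close> one after another. Adjacency of faces is not preserved by these maps. The relation
  \<open>joined\<close> is a stricter notion of chain, whose links are two faces with a common base point, two coplanar
  neighbours accompanied by a suitable third face, or two faces meeting along a ridge. Each map sends a link to a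
  chain of such links (\<open>joined_dual_subst_arnoux_rauzy\<close>), so any two faces stay joined, and joined faces lie in one
  connected component.

  Existence of the limit. A face and the faces in its image are at bounded distance after applying
  \<open>M\<close> to the latter (\<open>dual_subst_face_near\<close>). On the contracting plane \<open>M\<close> satisfies the quadratic factor of its
  characteristic polynomial whose roots are the conjugates of the Pisot number \<open>\<beta>\<close>; these lie inside the unit disc,
  so \<open>M\<^sup>n\<close> decays geometrically there (\<open>contracting_plane_decay\<close>). Hence \<open>D\<^sub>n\<close> and
  \<open>D\<^sub>n\<^sub>+\<^sub>1\<close> are within \<open>C r\<^sup>n\<close> of each other, with \<open>r < 1\<close>, and a Cauchy argument for compact
  sets applies (\<open>hausdorff_limit_exists\<close>).\<close>

section \<open>Duals of composed substitutions\<close>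

lemma substitution_append: "substitution \<sigma> \<Longrightarrow> \<sigma> (u @ v) = \<sigma> u @ \<sigma> v"
  by (simp add: substitution_def)

lemma substitution_Nil: "substitution \<sigma> \<Longrightarrow> \<sigma> [] = []"
  using substitution_append[of \<sigma> "[]" "[]"] by simp

lemma substitution_Cons: "substitution \<sigma> \<Longrightarrow> \<sigma> (a # w) = \<sigma> [a] @ \<sigma> w"
  using substitution_append[of \<sigma> "[a]" w] by simp

lemma substitution_eq_Nil_iff: "substitution \<sigma> \<Longrightarrow> \<sigma> w = [] \<longleftrightarrow> w = []"
proof (cases w)
  case (Cons a w')
  assume "substitution \<sigma>"
  then show ?thesis using Cons substitution_Cons[of \<sigma> a w'] by (simp add: substitution_def)
qed (simp add: substitution_Nil)

lemma substitution_comp: "substitution \<sigma> \<Longrightarrow> substitution \<tau> \<Longrightarrow> substitution (\<sigma> \<circ> \<tau>)"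
  using substitution_eq_Nil_iff by (force simp: substitution_def)

lemma substitution_id: "substitution id"
  by (simp add: substitution_def)

lemma abelianization_append: "abelianization (u @ v) = abelianization u + abelianization v"
  by (simp add: abelianization_def vec_eq_iff)

lemma abelianization_Nil: "abelianization [] = 0"
  by (simp add: abelianization_def vec_eq_iff)

lemma abelianization_singleton: "abelianization [a] = axis a 1"
  by (simp add: abelianization_def vec_eq_iff axis_def)

lemma incidence_matrix_axis:
  "(incidence_matrix \<sigma> :: 'a::comm_semiring_1 ^ letter ^ letter) *v axis a 1 = abelianization (\<sigma> [a])"
  by (simp add: incidence_matrix_def abelianization_def matrix_vector_mult_def axis_def vec_eq_iff
      if_distrib[of "\<lambda>x. _ * x"] cong: if_cong)

lemma abelianization_substitution:
  assumes "substitution \<sigma>"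
  shows "abelianization (\<sigma> w) = (incidence_matrix \<sigma> :: 'a::comm_semiring_1 ^ letter ^ letter) *v abelianization w"
proof (induction w)
  case (Cons a w)
  have "abelianization (\<sigma> (a # w)) = abelianization (\<sigma> [a]) + (abelianization (\<sigma> w) :: 'a ^ letter)"
    using assms by (simp add: substitution_Cons[of _ a w] abelianization_append)
  also have "\<dots> = incidence_matrix \<sigma> *v (abelianization [a] + abelianization w)"
    by (simp add: Cons incidence_matrix_axis abelianization_singleton matrix_vector_right_distrib)
  also have "abelianization [a] + abelianization w = (abelianization (a # w) :: 'a ^ letter)"
    using abelianization_append[of "[a]" w, where 'a = 'a] by simp
  finally show ?case .
qed (use assms in \<open>simp add: substitution_Nil abelianization_Nil\<close>)

lemma incidence_matrix_comp:
  assumes "substitution \<sigma>"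
  shows "incidence_matrix (\<sigma> \<circ> \<tau>) = (incidence_matrix \<sigma> :: 'a::comm_semiring_1 ^ letter ^ letter) ** incidence_matrix \<tau>"
proof -
  have "incidence_matrix (\<sigma> \<circ> \<tau>) $ i $ j =
      ((incidence_matrix \<sigma> :: 'a ^ letter ^ letter) ** incidence_matrix \<tau>) $ i $ j" for i j
    using arg_cong[OF abelianization_substitution[OF assms, of "\<tau> [j]", where 'a = 'a], of "\<lambda>x. x $ i"]
    by (simp add: abelianization_def incidence_matrix_def matrix_vector_mult_def matrix_matrix_mult_def)
  then show ?thesis by (simp add: vec_eq_iff)
qed

lemma incidence_matrix_id: "incidence_matrix id = mat 1"
  by (auto simp: incidence_matrix_def mat_def vec_eq_iff)

lemma matrix_inv_mult:
  fixes A :: "'a::semiring_1 ^ 'n ^ 'n"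
  assumes "invertible A"
  shows "A ** matrix_inv A = mat 1" "matrix_inv A ** A = mat 1"
  using someI_ex[OF assms[unfolded invertible_def]] by (simp_all add: matrix_inv_def)

lemma matrix_inv_vector_eq_iff:
  fixes A :: "'a::comm_semiring_1 ^ 'n ^ 'n"
  assumes "invertible A"
  shows "y = matrix_inv A *v x \<longleftrightarrow> A *v y = x"
  using matrix_inv_mult[OF assms] by (metis matrix_vector_mul_assoc matrix_vector_mul_lid)

text \<open>Stated without the inverse matrix, membership becomes an equation between integer vectors that
  can be rewritten.\<close>

lemma mem_dual_subst_face_iff:
  assumes "invertible (incidence_matrix \<sigma> :: int ^ letter ^ letter)"
  shows "(y, j) \<in> dual_subst_face \<sigma> (x, i) \<longleftrightarrow>
    (\<exists>p s. \<sigma> [j] = p @ [i] @ s \<and> incidence_matrix \<sigma> *v y = x + abelianization s)"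
  using matrix_inv_vector_eq_iff[OF assms] by (auto simp: dual_subst_face_def)

text \<open>An occurrence of a letter in \<open>\<sigma> w\<close> lies inside the image of a letter of \<open>w\<close>; this is
  what makes \<open>\<sigma> \<mapsto> E\<^sub>1\<^sup>*(\<sigma>)\<close> reverse compositions.\<close>

lemma letter_in_substitution_image_iff:
  assumes "substitution \<sigma>"
  shows "\<sigma> w = p @ [i] @ s \<longleftrightarrow>
    (\<exists>p1 a s1 p2 s2. w = p1 @ [a] @ s1 \<and> \<sigma> [a] = p2 @ [i] @ s2 \<and> p = \<sigma> p1 @ p2 \<and> s = s2 @ \<sigma> s1)"
    (is "?L w p \<longleftrightarrow> ?R w p")
proof
  show "?L w p \<Longrightarrow> ?R w p"
  proof (induction w arbitrary: p)
    case Nil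
    then show ?case by (simp add: substitution_Nil[OF assms])
  next
    case (Cons a w)
    from Cons.prems have eq: "\<sigma> [a] @ \<sigma> w = p @ i # s"
      using substitution_Cons[OF assms, of a w] by simp
    show ?case
    proof (cases "\<exists>q. p = \<sigma> [a] @ q")
      case True
      then obtain q where q: "p = \<sigma> [a] @ q" by blast
      then have "\<sigma> w = q @ [i] @ s" using eq by simp
      from Cons.IH[OF this] obtain p1 b s1 p2 s2 where
        "w = p1 @ [b] @ s1 \<and> \<sigma> [b] = p2 @ [i] @ s2 \<and> q = \<sigma> p1 @ p2 \<and> s = s2 @ \<sigma> s1" by blast
      then show ?thesis
        using q substitution_Cons[OF assms, of a p1]
        by (intro exI[of _ "a # p1"] exI[of _ b] exI[of _ s1] exI[of _ p2] exI[of _ s2]) simp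
    next
      case False
      with eq obtain s2 where "\<sigma> [a] = p @ i # s2" "s2 @ \<sigma> w = s"
        by (auto simp: append_eq_append_conv2 append_eq_Cons_conv)
      then show ?thesis
        using substitution_Nil[OF assms]
        by (intro exI[of _ "[]"] exI[of _ a] exI[of _ w] exI[of _ p] exI[of _ s2]) auto
    qed
  qed
  show "?R w p \<Longrightarrow> ?L w p"
    using substitution_append[OF assms] substitution_Cons[OF assms] by (metis append.assoc append_Cons append_Nil)
qed

text \<open>A face \<open>(y, j)\<close> of the image records a position in \<open>\<sigma> (\<tau> [j])\<close>, and that position is
  a position in \<open>\<tau> [j]\<close> together with one inside the image under \<open>\<sigma>\<close> of the letter found there. The suffix
  splits as \<open>s2 @ \<sigma> s1\<close>, whose abelianization is \<open>P s2 + M\<^sub>\<sigma> (P s1)\<close>, so applying the inverse of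
  \<open>M\<^sub>\<sigma> M\<^sub>\<tau>\<close> amounts to the two shifts in succession.\<close>

lemma dual_subst_comp:
  assumes \<sigma>: "substitution \<sigma>" and \<tau>: "substitution \<tau>"
    and inv: "invertible (incidence_matrix \<sigma> :: int ^ letter ^ letter)"
      "invertible (incidence_matrix \<tau> :: int ^ letter ^ letter)"
  shows "dual_subst (\<sigma> \<circ> \<tau>) X = dual_subst \<tau> (dual_subst \<sigma> X)"
proof -
  let ?S = "incidence_matrix \<sigma> :: int ^ letter ^ letter" and ?T = "incidence_matrix \<tau> :: int ^ letter ^ letter"
  have inv': "invertible (incidence_matrix (\<sigma> \<circ> \<tau>) :: int ^ letter ^ letter)"
    unfolding incidence_matrix_comp[OF \<sigma>] using inv by (rule invertible_mult)
  have "(y, j) \<in> dual_subst_face (\<sigma> \<circ> \<tau>) (x, i) \<longleftrightarrow>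
      (\<exists>z a. (z, a) \<in> dual_subst_face \<sigma> (x, i) \<and> (y, j) \<in> dual_subst_face \<tau> (z, a))" (is "?L \<longleftrightarrow> ?R") for x y i j
  proof
    assume ?L
    then obtain p s where "\<sigma> (\<tau> [j]) = p @ [i] @ s" and y: "?S *v (?T *v y) = x + abelianization s"
      unfolding mem_dual_subst_face_iff[OF inv'] incidence_matrix_comp[OF \<sigma>] matrix_vector_mul_assoc[symmetric]
      by auto
    then obtain p1 a s1 p2 s2 where *: "\<tau> [j] = p1 @ [a] @ s1" "\<sigma> [a] = p2 @ [i] @ s2" "s = s2 @ \<sigma> s1"
      using letter_in_substitution_image_iff[OF \<sigma>] by blast
    \<comment> \<open>The base point of the intermediate face is forced by the second shift.\<close>
    define z where "z = ?T *v y - abelianization s1"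
    have "?S *v z = x + abelianization s2"
      using y * abelianization_substitution[OF \<sigma>, of s1, where 'a = int]
      by (simp add: z_def matrix_vector_mult_diff_distrib abelianization_append)
    moreover have "?T *v y = z + abelianization s1" by (simp add: z_def)
    ultimately show ?R unfolding mem_dual_subst_face_iff[OF inv(1)] mem_dual_subst_face_iff[OF inv(2)] using * by blast
  next
    assume ?R
    then obtain z a p1 s1 p2 s2 where *: "\<tau> [j] = p1 @ [a] @ s1" "\<sigma> [a] = p2 @ [i] @ s2"
      "?S *v z = x + abelianization s2" "?T *v y = z + abelianization s1"
      unfolding mem_dual_subst_face_iff[OF inv(1)] mem_dual_subst_face_iff[OF inv(2)] by blast
    then have "(\<sigma> \<circ> \<tau>) [j] = (\<sigma> p1 @ p2) @ [i] @ (s2 @ \<sigma> s1)"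
      by (simp add: substitution_append[OF \<sigma>] substitution_Cons[OF \<sigma>, of a s1])
    moreover have "?S *v (?T *v y) = x + abelianization (s2 @ \<sigma> s1)"
      using * abelianization_substitution[OF \<sigma>, of s1, where 'a = int]
      by (simp add: matrix_vector_right_distrib abelianization_append add.assoc)
    ultimately show ?L
      unfolding mem_dual_subst_face_iff[OF inv'] incidence_matrix_comp[OF \<sigma>] matrix_vector_mul_assoc[symmetric]
      by blast
  qed
  then show ?thesis
    unfolding dual_subst_def by fast
qed

lemma dual_subst_id: "dual_subst id X = X"
proof -
  have inv: "invertible (incidence_matrix id :: int ^ letter ^ letter)"
    by (simp add: incidence_matrix_id invertible_def)
  have "(y, j) \<in> dual_subst_face id (x, i) \<longleftrightarrow> (y, j) = (x, i)" for x y i j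
    unfolding mem_dual_subst_face_iff[OF inv]
    by (auto simp: incidence_matrix_id Cons_eq_append_conv abelianization_Nil)
  then show ?thesis unfolding dual_subst_def by auto
qed

lemma substitution_arnoux_rauzy: "substitution (arnoux_rauzy k)"
  by (simp add: substitution_def arnoux_rauzy_def)

lemma distinct_letters_UNIV:
  fixes i j k :: letter
  assumes "i \<noteq> j" "i \<noteq> k" "j \<noteq> k"
  shows "UNIV = {i, j, k}"
  using assms card_subset_eq[of UNIV "{i, j, k}"] by auto

lemma sum_letter:
  fixes f :: "letter \<Rightarrow> 'a::comm_monoid_add"
  assumes "i \<noteq> j" "i \<noteq> k" "j \<noteq> k"
  shows "sum f UNIV = f i + f j + f k"
  unfolding distinct_letters_UNIV[OF assms] using assms by (simp add: add.assoc)

lemma letters_other: obtains i j :: letter where "i \<noteq> j" "i \<noteq> k" "j \<noteq> k" "UNIV = {i, j, k}"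
proof -
  have "card (UNIV - {k}) = 2" by (simp add: card_Diff_singleton)
  then obtain i j where "UNIV - {k} = {i, j}" "i \<noteq> j" by (meson card_2_iff)
  then show ?thesis by (intro that[of i j]) auto
qed

lemma invertible_incidence_matrix_arnoux_rauzy:
  "invertible (incidence_matrix (arnoux_rauzy k) :: int ^ letter ^ letter)"
proof -
  define A where "A = (incidence_matrix (arnoux_rauzy k) :: int ^ letter ^ letter)"
  define B :: "int ^ letter ^ letter" where
    "B = (\<chi> l j. if l = j then 1 else if l = k then - 1 else 0)"
  obtain i j where ij: "i \<noteq> j" "i \<noteq> k" "j \<noteq> k" by (rule letters_other)
  have A: "A $ l $ j = (if l = k \<or> l = j then 1 else 0)" for l j
    by (auto simp: A_def incidence_matrix_def arnoux_rauzy_def)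
  have "l = i \<or> l = j \<or> l = k" for l
    using distinct_letters_UNIV[OF ij] by blast
  then have "A ** B = mat 1" "B ** A = mat 1"
    using ij
    by (fastforce simp: vec_eq_iff matrix_matrix_mult_def sum_letter[OF ij] A B_def mat_def)+
  then show ?thesis unfolding invertible_def A_def by blast
qed

section \<open>Chains of faces under the dual Arnoux-Rauzy substitutions\<close>

text \<open>The action of \<open>E\<^sub>1\<^sup>*(\<sigma>\<^sub>k)\<close> on base points, before the shift by the suffix; it fixes
  \<open>e\<^sub>k\<close> and sends every other \<open>e\<^sub>i\<close> to \<open>e\<^sub>i - e\<^sub>k\<close>.\<close>

definition shear :: "letter \<Rightarrow> int ^ letter \<Rightarrow> int ^ letter" where
  "shear k x = matrix_inv (incidence_matrix (arnoux_rauzy k)) *v x"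

lemma shear_add: "shear k (x + y) = shear k x + shear k y"
  and shear_diff: "shear k (x - y) = shear k x - shear k y"
  by (simp_all add: shear_def matrix_vector_right_distrib matrix_vector_mult_diff_distrib)

lemma shear_eq_iff: "y = shear k x \<longleftrightarrow> incidence_matrix (arnoux_rauzy k) *v y = x"
  unfolding shear_def by (rule matrix_inv_vector_eq_iff[OF invertible_incidence_matrix_arnoux_rauzy])

lemma shear_axis: "shear k (axis i 1) = (if i = k then axis k 1 else axis i 1 - axis k 1)"
proof -
  have "(if i = k then axis k 1 else axis i 1 - axis k 1) = shear k (axis i 1)"
    unfolding shear_eq_iff
    using abelianization_append[of "[i]" "[k]", where 'a = int]
    by (auto simp: matrix_vector_mult_diff_distrib incidence_matrix_axis arnoux_rauzy_def abelianization_singleton)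
  then show ?thesis ..
qed

text \<open>The letter \<open>k\<close> ends the image of each letter, so a face of type \<open>k\<close> is replaced by a whole
  corner of three faces; another letter \<open>i\<close> occurs only in the image of \<open>i\<close>, followed by \<open>k\<close>, so a face
  of type \<open>i\<close> merely moves.\<close>

lemma dual_subst_face_arnoux_rauzy:
  "f \<in> dual_subst_face (arnoux_rauzy k) (x, i) \<longleftrightarrow>
    (if i = k then fst f = shear k x else f = (shear k x + axis k 1, i))"
proof -
  obtain y j where f: "f = (y, j)" by (cases f)
  have 1: "shear k x + axis k 1 = shear k (x + axis k 1)" by (simp add: shear_add shear_axis)
  have 2: "(\<exists>p s. arnoux_rauzy k [j] = p @ [i] @ s \<and> Q (abelianization s)) \<longleftrightarrow>
    (if i = k then Q 0 else i = j \<and> Q (axis k 1))" for Q :: "int ^ letter \<Rightarrow> bool"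
    by (auto simp: arnoux_rauzy_def Cons_eq_append_conv abelianization_Nil abelianization_singleton)
  show ?thesis
    unfolding f mem_dual_subst_face_iff[OF invertible_incidence_matrix_arnoux_rauzy]
      2[of "\<lambda>s. incidence_matrix (arnoux_rauzy k) *v y = x + s"]
    using shear_eq_iff[of y k x] shear_eq_iff[of y k "x + axis k 1"] 1 by auto
qed

text \<open>The equivalence relation on the faces of \<open>P\<close> generated by three kinds of pairs of intersecting
  faces. Intersecting faces in general cannot be used: iterating \<open>E\<^sub>1\<^sup>*(\<sigma>\<^sub>j)\<close> moves the coplanar
  neighbours \<open>(x, i)\<close> and \<open>(x + e\<^sub>k, i)\<close>, with \<open>i\<close>, \<open>j\<close>, \<open>k\<close> distinct, apart along multiples of \<open>e\<^sub>j\<close>.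
  Therefore the rule \<open>floor\<close> accepts coplanar neighbours only in the presence of a third face, one at \<open>x\<close>
  whose type is the remaining letter: that face is the one that grows into a corner joining the two images in the
  dangerous case. The rule \<open>ridge\<close> holds for the two new faces that appear when the coplanar faces themselves
  grow into corners. The relation generated by these pairs passes to images.\<close>

inductive joined :: "face set \<Rightarrow> face \<Rightarrow> face \<Rightarrow> bool" for P where
  corner: "(x, i) \<in> P \<Longrightarrow> (x, j) \<in> P \<Longrightarrow> joined P (x, i) (x, j)"
| floor: "i \<noteq> j \<Longrightarrow> i \<noteq> k \<Longrightarrow> j \<noteq> k \<Longrightarrow> (x, i) \<in> P \<Longrightarrow> (x + axis k 1, i) \<in> P \<Longrightarrow> (x, j) \<in> P \<Longrightarrow>
    joined P (x, i) (x + axis k 1, i)"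
| ridge: "i \<noteq> j \<Longrightarrow> (x, j) \<in> P \<Longrightarrow> (x + axis i 1 - axis j 1, i) \<in> P \<Longrightarrow>
    joined P (x, j) (x + axis i 1 - axis j 1, i)"
| sym: "joined P f g \<Longrightarrow> joined P g f"
| trans: "joined P f g \<Longrightarrow> joined P g h \<Longrightarrow> joined P f h"

lemma dual_subst_face_arnoux_rauzy_nonempty: "\<exists>g. g \<in> dual_subst_face (arnoux_rauzy k) f"
  by (cases f) (auto simp: dual_subst_face_arnoux_rauzy split: if_splits)

text \<open>The heart of the proof. Up to translation, the image of a generating pair and its context under
  \<open>E\<^sub>1\<^sup>*(\<sigma>\<^sub>m)\<close> is again linked by chains of generating pairs, by a case distinction on which of the
  letters involved equals \<open>m\<close>. Each face has a nonempty image, so chains pass to images as well.\<close>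

lemma joined_dual_subst_arnoux_rauzy:
  assumes "joined P f g" "f' \<in> dual_subst_face (arnoux_rauzy m) f" "g' \<in> dual_subst_face (arnoux_rauzy m) g"
  shows "joined (dual_subst (arnoux_rauzy m) P) f' g'"
  using assms
proof (induction arbitrary: f' g')
  let ?E = "dual_subst (arnoux_rauzy m) P" and ?S = "shear m"
  note ar = dual_subst_face_arnoux_rauzy
  have own: "(?S x, a) \<in> ?E" if "(x, m) \<in> P" for x a
    using that ar[of "(?S x, a)" m x m] by (auto simp: dual_subst_def)
  have other: "(?S x + axis m 1, i) \<in> ?E" if "(x, i) \<in> P" "i \<noteq> m" for x i
    using that ar[of "(?S x + axis m 1, i)" m x i] by (force simp: dual_subst_def)
  \<comment> \<open>The corner grown from the face of type m is joined to the
    moved face through the face of the corner that has the same type as the moved one; the context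
    for this is the third face of the corner.\<close>
  have step: "joined ?E (?S x, a) (?S x + axis m 1, i)" if "(x, m) \<in> P" "(x, i) \<in> P" and "i \<noteq> m" for x i a
  proof -
    obtain k where k: "i \<noteq> k" "k \<noteq> m" using letters_other[of m] \<open>i \<noteq> m\<close> by metis
    have "joined ?E (?S x, i) (?S x + axis m 1, i)"
      using k \<open>i \<noteq> m\<close> \<open>(x, m) \<in> P\<close> \<open>(x, i) \<in> P\<close> own other by (intro joined.floor[of i k]) auto
    then show ?thesis using joined.corner[OF own own] \<open>(x, m) \<in> P\<close> joined.trans by blast
  qed
  {
    case (corner x i j)
    show ?case
    proof (cases "i = m \<or> j = m")
      case True
      then show ?thesis
        using corner ar[of f' m x i] ar[of g' m x j] step[of x i] step[of x j] joined.corner[OF own own]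
        by (cases f'; cases g') (auto intro: joined.sym split: if_splits)
    next
      case False
      then show ?thesis
        using corner ar[of f' m x i] ar[of g' m x j] other[of x i] other[of x j] by (auto intro: joined.corner)
    qed
  next
    case (floor i j k x)
    let ?y = "?S x"
    consider "m = k" | "m = i" | "m = j"
      using distinct_letters_UNIV[of i j k] floor by blast
    then show ?case
    proof cases
      case 1
      then have f': "f' = (?y + axis k 1, i)" and g': "g' = (?y + axis k 1 + axis k 1, i)"
        using floor ar[of f' m x i] ar[of g' m "x + axis k 1" i] by (auto simp: shear_add shear_axis)
      show ?thesis
        unfolding f' g'
        using 1 floor other[of x i] other[of "x + axis k 1" i] other[of x j]
        by (intro joined.floor[of i j k]) (auto simp: shear_add shear_axis)
    next
      case 2
      \<comment> \<open>Both faces become corners, at two points that differ by e_k - e_i: these are joined along a ridge.\<close>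
      obtain a b where ab: "f' = (?y, a)" "g' = (?y + axis k 1 - axis i 1, b)"
        using 2 floor ar[of f' m x i] ar[of g' m "x + axis k 1" i]
        by (cases f'; cases g') (auto simp: shear_add shear_axis)
      have *: "(?y + axis k 1 - axis i 1, c) \<in> ?E" "(?y, c) \<in> ?E" for c
        using 2 floor own[of x] own[of "x + axis k 1"] by (auto simp: shear_add shear_axis add_diff_eq)
      have "joined ?E (?y, i) (?y + axis k 1 - axis i 1, k)"
        using * floor by (intro joined.ridge) auto
      then show ?thesis
        unfolding ab using joined.corner[OF *(1) *(1)] joined.corner[OF *(2) *(2)] joined.trans by blast
    next
      case 3
      \<comment> \<open>The images sit at ?y + e_j and ?y + e_k and may only meet in a point, but the face (x, j) has
        become a corner at ?y whose face of type i is a coplanar neighbour of both.\<close>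
      have f': "f' = (?y + axis j 1, i)" and g': "g' = (?y + axis k 1, i)"
        using 3 floor ar[of f' m x i] ar[of g' m "x + axis k 1" i] by (auto simp: shear_add shear_axis)
      have *: "(?y, c) \<in> ?E" "(?y + axis j 1, i) \<in> ?E" "(?y + axis k 1, i) \<in> ?E" for c
        using 3 floor own[of x] other[of x i] other[of "x + axis k 1" i] by (auto simp: shear_add shear_axis)
      have "joined ?E (?y, i) (?y + axis j 1, i)"
        using * floor by (intro joined.floor[of i k j]) auto
      moreover have "joined ?E (?y, i) (?y + axis k 1, i)"
        using * floor by (intro joined.floor[of i j k]) auto
      ultimately show ?thesis unfolding f' g' by (blast intro: joined.sym joined.trans)
    qed
  next
    case (ridge i j x)
    let ?y = "?S x"
    consider "m = i" | "m = j" | "m \<noteq> i" "m \<noteq> j" by blast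
    then show ?case
    proof cases
      case 1
      let ?z = "?y + axis i 1"
      have f': "f' = (?z, j)" and g': "fst g' = ?z + axis i 1 - axis j 1"
        using 1 ridge ar[of f' m x j] ar[of g' m "x + axis i 1 - axis j 1" i]
        by (auto simp: shear_add shear_diff shear_axis)
      have *: "(?z, j) \<in> ?E" "(?z + axis i 1 - axis j 1, c) \<in> ?E" for c
        using 1 ridge own[of "x + axis i 1 - axis j 1"] other[of x j]
        by (auto simp: shear_add shear_diff shear_axis algebra_simps)
      have "joined ?E (?z, j) (?z + axis i 1 - axis j 1, i)"
        using * ridge by (intro joined.ridge) auto
      then show ?thesis
        using f' g' joined.corner[OF *(2) *(2)] joined.trans by (metis prod.collapse)
    next
      case 2
      have f': "fst f' = ?y" and g': "g' = (?y + axis i 1 - axis j 1, i)"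
        using 2 ridge ar[of f' m x j] ar[of g' m "x + axis i 1 - axis j 1" i]
        by (auto simp: shear_add shear_diff shear_axis)
      have *: "(?y, c) \<in> ?E" "(?y + axis i 1 - axis j 1, i) \<in> ?E" for c
        using 2 ridge own[of x] other[of "x + axis i 1 - axis j 1" i]
        by (auto simp: shear_add shear_diff shear_axis algebra_simps)
      have "joined ?E (?y, j) (?y + axis i 1 - axis j 1, i)"
        using * ridge by (intro joined.ridge) auto
      then show ?thesis
        using f' g' joined.corner[OF *(1) *(1)] joined.trans by (metis prod.collapse)
    next
      case 3
      let ?z = "?y + axis m 1"
      have f': "f' = (?z, j)" and g': "g' = (?z + axis i 1 - axis j 1, i)"
        using 3 ridge ar[of f' m x j] ar[of g' m "x + axis i 1 - axis j 1" i]
        by (auto simp: shear_add shear_diff shear_axis)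
      show ?thesis
        unfolding f' g'
        using 3 ridge other[of x j] other[of "x + axis i 1 - axis j 1" i]
        by (intro joined.ridge) (auto simp: shear_add shear_diff shear_axis algebra_simps)
    qed
  next
    case (sym f g)
    then show ?case by (blast intro: joined.sym)
  next
    case (trans f g h)
    then show ?case using dual_subst_face_arnoux_rauzy_nonempty by (blast intro: joined.trans)
  }
qed

section \<open>Connectedness of the approximations\<close>

lemma arnoux_rauzy_product_Nil: "arnoux_rauzy_product [] = id"
  and arnoux_rauzy_product_Cons:
    "arnoux_rauzy_product (k # ks) = arnoux_rauzy k \<circ> arnoux_rauzy_product ks"
  by (simp_all add: arnoux_rauzy_product_def)

lemma substitution_arnoux_rauzy_product: "substitution (arnoux_rauzy_product ks)"
  by (induction ks) (simp_all only: arnoux_rauzy_product_Nil arnoux_rauzy_product_Cons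
      substitution_id substitution_comp substitution_arnoux_rauzy)

lemma invertible_incidence_matrix_arnoux_rauzy_product:
  "invertible (incidence_matrix (arnoux_rauzy_product ks) :: int ^ letter ^ letter)"
proof (induction ks)
  case Nil
  show ?case unfolding arnoux_rauzy_product_Nil incidence_matrix_id invertible_def
    by (rule exI[of _ "mat 1"]) simp
next
  case (Cons k ks)
  then show ?case
    by (simp only: arnoux_rauzy_product_Cons incidence_matrix_comp[OF substitution_arnoux_rauzy]
        invertible_mult invertible_incidence_matrix_arnoux_rauzy)
qed

lemma dual_subst_arnoux_rauzy_product_Cons:
  "dual_subst (arnoux_rauzy_product (k # ks)) P =
    dual_subst (arnoux_rauzy_product ks) (dual_subst (arnoux_rauzy k) P)"
  unfolding arnoux_rauzy_product_Cons
  by (intro dual_subst_comp substitution_arnoux_rauzy substitution_arnoux_rauzy_product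
      invertible_incidence_matrix_arnoux_rauzy invertible_incidence_matrix_arnoux_rauzy_product)

lemma dual_subst_arnoux_rauzy_product_nonempty:
  "P \<noteq> {} \<Longrightarrow> dual_subst (arnoux_rauzy_product ks) P \<noteq> {}"
proof (induction ks arbitrary: P)
  case (Cons k ks)
  have "dual_subst (arnoux_rauzy k) P \<noteq> {}"
    using Cons.prems dual_subst_face_arnoux_rauzy_nonempty by (fastforce simp: dual_subst_def)
  then show ?case
    unfolding dual_subst_arnoux_rauzy_product_Cons by (rule Cons.IH)
qed (simp add: arnoux_rauzy_product_Nil dual_subst_id)

definition all_joined :: "face set \<Rightarrow> bool" where
  "all_joined P \<longleftrightarrow> (\<forall>f\<in>P. \<forall>g\<in>P. joined P f g)"

text \<open>The factors act one at a time, the outermost first.\<close>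

lemma all_joined_dual_subst_arnoux_rauzy_product:
  "all_joined P \<Longrightarrow> all_joined (dual_subst (arnoux_rauzy_product ks) P)"
proof (induction ks arbitrary: P)
  case (Cons k ks)
  have "all_joined (dual_subst (arnoux_rauzy k) P)"
    using Cons.prems joined_dual_subst_arnoux_rauzy
    unfolding all_joined_def dual_subst_def by blast
  then show ?case
    unfolding dual_subst_arnoux_rauzy_product_Cons by (rule Cons.IH)
qed (simp add: arnoux_rauzy_product_Nil dual_subst_id)

lemma all_joined_corner: "all_joined corner"
  unfolding all_joined_def by (auto simp: corner_def intro: joined.corner)

definition real_point :: "int ^ letter \<Rightarrow> real ^ letter" where
  "real_point x = (\<chi> l. real_of_int (x $ l))"

text \<open>The description by coordinates makes convexity and common points of faces evident.\<close>

lemma unit_face_eq: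
  "unit_face (x, i) =
    {y. y $ i = real_of_int (x $ i) \<and> (\<forall>l. l \<noteq> i \<longrightarrow> real_of_int (x $ l) \<le> y $ l \<and> y $ l \<le> real_of_int (x $ l) + 1)}"
    (is "_ = ?R")
proof
  show "unit_face (x, i) \<subseteq> ?R"
  proof
    fix y assume "y \<in> unit_face (x, i)"
    then obtain a b j k where *: "y = (\<chi> l. real_of_int (x $ l)) + a *\<^sub>R axis j 1 + b *\<^sub>R axis k 1"
      "a \<in> {0..1}" "b \<in> {0..1}" "{i, j, k} = UNIV"
      by (auto simp: unit_face_def)
    have "card {i, j, k} = 3" using *(4) by simp
    then have "i \<noteq> j" "i \<noteq> k" "j \<noteq> k" by (auto simp: card_insert_if split: if_splits)
    then show "y \<in> ?R" using * by (auto simp: axis_def)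
  qed
  show "?R \<subseteq> unit_face (x, i)"
  proof
    fix y assume y: "y \<in> ?R"
    obtain j k where jk: "j \<noteq> k" "j \<noteq> i" "k \<noteq> i" "UNIV = {j, k, i}" by (rule letters_other)
    have "y $ l = ((\<chi> l. real_of_int (x $ l)) + (y $ j - x $ j) *\<^sub>R axis j 1 + (y $ k - x $ k) *\<^sub>R axis k 1) $ l" for l
    proof -
      have "l \<in> {j, k, i}" unfolding jk(4)[symmetric] ..
      then show ?thesis using jk(1-3) y by (auto simp: axis_def)
    qed
    then have eq: "y = (\<chi> l. real_of_int (x $ l)) + (y $ j - x $ j) *\<^sub>R axis j 1 + (y $ k - x $ k) *\<^sub>R axis k 1"
      unfolding vec_eq_iff by blast
    have "{i, j, k} = UNIV" using jk(4) by auto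
    moreover have "y $ j - x $ j \<in> {0..1}" "y $ k - x $ k \<in> {0..1}" using y jk(1-3) by auto
    ultimately show "y \<in> unit_face (x, i)"
      unfolding unit_face_def prod.case mem_Collect_eq
      by (intro exI[of _ "y $ j - x $ j"] exI[of _ "y $ k - x $ k"] exI[of _ j] exI[of _ k] conjI eq)
  qed
qed

lemma convex_unit_face: "convex (unit_face f)"
proof (cases f)
  case (Pair x i)
  have "unit_face f = {y. axis i 1 \<bullet> y = real_of_int (x $ i)} \<inter>
    (\<Inter>l\<in>-{i}. {y. axis l 1 \<bullet> y \<ge> real_of_int (x $ l)} \<inter> {y. axis l 1 \<bullet> y \<le> real_of_int (x $ l) + 1})"
    unfolding Pair unit_face_eq by (auto simp: inner_axis')
  also have "convex \<dots>"
    by (intro convex_Int convex_INT ballI convex_hyperplane convex_halfspace_le convex_halfspace_ge)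
  finally show ?thesis .
qed

lemma real_point_in_unit_face: "real_point x \<in> unit_face (x, i)"
  by (simp add: unit_face_eq real_point_def)

text \<open>Faces are convex, and the faces of a generating pair meet: in \<open>x\<close> for a corner, in
  \<open>x + e\<^sub>k\<close> for \<open>floor\<close>, and in \<open>x + e\<^sub>i\<close> for \<open>ridge\<close>.\<close>

lemma joined_imp_connected_component:
  assumes "joined P f g" "a \<in> unit_face f" "b \<in> unit_face g"
  shows "connected_component (faces_union P) a b"
proof -
  have face: "connected_component (faces_union P) a b" if "f \<in> P" "a \<in> unit_face f" "b \<in> unit_face f" for f a b
    using that convex_connected[OF convex_unit_face[of f]]
    unfolding connected_component_def faces_union_def by blast
  have meet: "connected_component (faces_union P) a b"
    if "f \<in> P" "g \<in> P" "c \<in> unit_face f" "c \<in> unit_face g" "a \<in> unit_face f" "b \<in> unit_face g" for f g a b c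
    using face[of f a c] face[of g c b] that connected_component_trans by blast
  show ?thesis
    using assms
  proof (induction arbitrary: a b)
    case (corner x i j)
    then show ?case using meet[of "(x, i)" "(x, j)" "real_point x"] real_point_in_unit_face by blast
  next
    case (floor i j k x)
    have "real_point (x + axis k 1) \<in> unit_face (x, i)"
      using floor by (auto simp: unit_face_eq real_point_def axis_def)
    then show ?case
      using floor meet[of "(x, i)" "(x + axis k 1, i)"] real_point_in_unit_face by blast
  next
    case (ridge i j x)
    have "real_point (x + axis i 1) \<in> unit_face (x, j)"
      "real_point (x + axis i 1) \<in> unit_face (x + axis i 1 - axis j 1, i)"
      using ridge by (auto simp: unit_face_eq real_point_def axis_def)
    then show ?case
      using ridge meet[of "(x, j)" "(x + axis i 1 - axis j 1, i)"] by blast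
  next
    case (sym f g)
    then show ?case by (blast intro: connected_component_sym)
  next
    case (trans f g h)
    obtain c where "c \<in> unit_face g" using real_point_in_unit_face by (cases g) blast
    then show ?case using trans.IH trans.prems connected_component_trans by blast
  qed
qed

lemma all_joined_imp_connected: "all_joined P \<Longrightarrow> connected (faces_union P)"
  unfolding connected_iff_connected_component all_joined_def
  using joined_imp_connected_component unfolding faces_union_def by blast

lemma dual_subst_iterates_corner:
  fixes ks n
  defines "P \<equiv> (dual_subst (arnoux_rauzy_product ks) ^^ n) corner"
  shows "all_joined P" "P \<noteq> {}"
proof -
  have "corner \<noteq> {}" by (simp add: corner_def)
  then show "all_joined P" "P \<noteq> {}"
    unfolding P_def
    by (induction n) (simp_all add: all_joined_corner all_joined_dual_subst_arnoux_rauzy_product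
        dual_subst_arnoux_rauzy_product_nonempty)
qed

lemma connected_rauzy_approx:
  "connected (rauzy_approx (arnoux_rauzy_product ks) u v n)"
proof -
  have lin: "linear (contracting_projection u v)"
    unfolding contracting_projection_def
    by (intro linearI) (simp_all add: inner_add_left add_divide_distrib algebra_simps)
  let ?M = "incidence_matrix (arnoux_rauzy_product ks) :: real ^ letter ^ letter"
  have "continuous_on UNIV (((*v) ?M) ^^ n)"
  proof (induction n)
    case (Suc n)
    have "continuous_on UNIV (\<lambda>x. ?M *v (((*v) ?M) ^^ n) x)"
      by (intro continuous_on_compose2[OF matrix_vector_mult_linear_continuous_on Suc]) auto
    then show ?case by (simp add: o_def)
  qed (simp add: id_def)
  moreover have "continuous_on UNIV (contracting_projection u v)"
    using lin linear_continuous_on linear_conv_bounded_linear by blast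
  ultimately show ?thesis
    unfolding rauzy_approx_def
    by (intro connected_continuous_image all_joined_imp_connected dual_subst_iterates_corner)
       (blast intro: continuous_on_subset)+
qed

section \<open>Contraction on the plane orthogonal to the left eigenvector\<close>

text \<open>The sum of the principal minors of order two.\<close>

definition second_coefficient :: "'a::comm_ring_1 ^ 3 ^ 3 \<Rightarrow> 'a" where
  "second_coefficient M = M $ 1 $ 1 * M $ 2 $ 2 - M $ 1 $ 2 * M $ 2 $ 1 + M $ 1 $ 1 * M $ 3 $ 3
    - M $ 1 $ 3 * M $ 3 $ 1 + M $ 2 $ 2 * M $ 3 $ 3 - M $ 2 $ 3 * M $ 3 $ 2"

lemma characteristic_poly_3:
  fixes M :: "'a::comm_ring_1 ^ 3 ^ 3"
  shows "characteristic_poly M = [:- det M, second_coefficient M, - trace M, 1:]"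
  by (simp add: characteristic_poly_def det_3 mat_def second_coefficient_def trace_def sum_3 algebra_simps)

lemma cayley_hamilton_3:
  fixes M :: "'a::comm_ring_1 ^ 3 ^ 3"
  shows "M *v (M *v (M *v x)) = trace M *s (M *v (M *v x)) - second_coefficient M *s (M *v x) + det M *s x"
  by (simp add: vec_eq_iff forall_3 matrix_vector_mult_def sum_3 second_coefficient_def trace_def det_3 algebra_simps)

lemma map_characteristic_poly_incidence_matrix:
  "map_poly of_rat (characteristic_poly (incidence_matrix \<sigma>)) =
    (characteristic_poly (incidence_matrix \<sigma>) :: 'a::field_char_0 poly)"
  by (simp add: characteristic_poly_3 map_poly_pCons second_coefficient_def trace_def sum_3 det_3
      incidence_matrix_def of_rat_add of_rat_diff of_rat_mult of_rat_minus)

text \<open>By the Cayley-Hamilton identity, the characteristic polynomial evaluated at \<open>c\<close> kills the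
  eigenvector.\<close>

lemma eigenvector_imp_root:
  fixes M :: "'a::field ^ 3 ^ 3"
  assumes "eigenvector M c x"
  shows "poly (characteristic_poly M) c = 0"
proof -
  have x: "x \<noteq> 0" "M *v x = c *s x" using assms by (auto simp: eigenvector_def)
  have "poly (characteristic_poly M) c *s x = 0"
    using cayley_hamilton_3[of M x] x(2)
    by (simp add: characteristic_poly_3 vector_scalar_commute vec_eq_iff algebra_simps)
  then show ?thesis using x(1) by simp
qed

lemma map_poly_of_rat:
  fixes p q :: "rat poly"
  shows "map_poly of_rat (p + q) = (map_poly of_rat p + map_poly of_rat q :: 'a::field_char_0 poly)"
    and "map_poly of_rat (p * q) = (map_poly of_rat p * map_poly of_rat q :: 'a poly)"
    and "map_poly of_rat (pderiv p) = (pderiv (map_poly of_rat p) :: 'a poly)"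
  by (rule poly_eqI, simp add: coeff_map_poly coeff_mult coeff_pderiv of_rat_sum of_rat_mult of_rat_add)+

context
  fixes \<sigma> :: "word \<Rightarrow> word"
  assumes irr: "irreducible (characteristic_poly (incidence_matrix \<sigma> :: rat ^ letter ^ letter))"
begin

lemma characteristic_poly_no_rational_root:
  "poly (characteristic_poly (incidence_matrix \<sigma>)) (r :: rat) \<noteq> 0"
proof
  let ?p = "characteristic_poly (incidence_matrix \<sigma> :: rat ^ letter ^ letter)"
  assume "poly ?p r = 0"
  then obtain q where q: "?p = [:- r, 1:] * q" by (auto simp: poly_eq_0_iff_dvd)
  have "q \<noteq> 0" using q by (auto simp: characteristic_poly_3)
  then have "degree ?p = 1 + degree q" unfolding q by (subst degree_mult_eq) auto
  then have "degree q = 2" by (simp add: characteristic_poly_3)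
  then show False
    using irreducibleD[OF irr q] \<open>q \<noteq> 0\<close> by (auto simp: is_unit_iff_degree)
qed

text \<open>An irreducible polynomial over a field of characteristic zero is coprime to its derivative, so
  a Bezout identity excludes common roots in any extension field.\<close>

lemma characteristic_poly_simple_root:
  fixes c :: "'a::field_char_0"
  assumes "poly (characteristic_poly (incidence_matrix \<sigma>)) c = 0"
  shows "poly (pderiv (characteristic_poly (incidence_matrix \<sigma>))) c \<noteq> 0"
proof
  let ?p = "characteristic_poly (incidence_matrix \<sigma> :: rat ^ letter ^ letter)"
  assume root: "poly (pderiv (characteristic_poly (incidence_matrix \<sigma>))) c = 0"
  have "\<not> ?p dvd pderiv ?p"
  proof
    assume "?p dvd pderiv ?p"
    moreover have "pderiv ?p \<noteq> 0" by (simp add: characteristic_poly_3 pderiv_pCons)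
    ultimately have "degree ?p \<le> degree (pderiv ?p)" by (rule dvd_imp_degree_le)
    then show False by (simp add: characteristic_poly_3 degree_pderiv)
  qed
  then have "coprime ?p (pderiv ?p)"
    using irr by (intro prime_elem_imp_coprime irreducible_imp_prime_elem)
  then have "fst (bezout_coefficients ?p (pderiv ?p)) * ?p + snd (bezout_coefficients ?p (pderiv ?p)) * pderiv ?p = 1"
    by (simp add: bezout_coefficients_fst_snd)
  then obtain a b where "a * ?p + b * pderiv ?p = 1" by blast
  then have "map_poly (of_rat :: rat \<Rightarrow> 'a) (a * ?p + b * pderiv ?p) = map_poly of_rat 1" by simp
  then have "map_poly of_rat a * map_poly of_rat ?p + map_poly of_rat b * pderiv (map_poly of_rat ?p) = (1 :: 'a poly)"
    by (simp add: map_poly_of_rat)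
  then have "poly (map_poly of_rat a * map_poly of_rat ?p + map_poly of_rat b * pderiv (map_poly of_rat ?p)) c = 1"
    by simp
  then show False
    using assms root by (simp add: map_characteristic_poly_incidence_matrix)
qed

text \<open>If the incidence matrix were block triangular up to a permutation of the letters, then a diagonal
  entry would be an eigenvalue and hence a rational root. This replaces primitivity in the Perron-Frobenius
  arguments below.\<close>

lemma incidence_matrix_not_block_triangular:
  assumes "i \<noteq> j" "i \<noteq> k" "j \<noteq> k"
  shows "\<not> (count_list (\<sigma> [i]) k = 0 \<and> count_list (\<sigma> [j]) k = 0)"
    and "\<not> (count_list (\<sigma> [i]) k = 0 \<and> count_list (\<sigma> [i]) j = 0)"
proof -
  have *: "(i, j, k) \<in> {(1, 2, 3), (1, 3, 2), (2, 1, 3), (2, 3, 1), (3, 1, 2), (3, 2, 1)}"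
    using assms exhaust_3[of i] exhaust_3[of j] exhaust_3[of k] by auto
  show "\<not> (count_list (\<sigma> [i]) k = 0 \<and> count_list (\<sigma> [j]) k = 0)"
  proof
    assume "count_list (\<sigma> [i]) k = 0 \<and> count_list (\<sigma> [j]) k = 0"
    then show False
      using * characteristic_poly_no_rational_root[of "of_nat (count_list (\<sigma> [k]) k)"]
      by (auto simp: characteristic_poly_3 second_coefficient_def trace_def sum_3 det_3 incidence_matrix_def algebra_simps)
  qed
  show "\<not> (count_list (\<sigma> [i]) k = 0 \<and> count_list (\<sigma> [i]) j = 0)"
  proof
    assume "count_list (\<sigma> [i]) k = 0 \<and> count_list (\<sigma> [i]) j = 0"
    then show False
      using * characteristic_poly_no_rational_root[of "of_nat (count_list (\<sigma> [i]) i)"]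
      by (auto simp: characteristic_poly_3 second_coefficient_def trace_def sum_3 det_3 incidence_matrix_def algebra_simps)
  qed
qed


text \<open>Where an eigenvector with nonnegative entries vanishes, the corresponding rows of the matrix
  vanish on its support, which gives a block of zeros.\<close>

lemma nonneg_eigenvector_imp_pos:
  fixes z :: "real ^ letter"
  assumes eig: "incidence_matrix \<sigma> *v z = \<beta> *s z" and nonneg: "\<And>i. z $ i \<ge> 0" and "z \<noteq> 0"
  shows "z $ k > 0"
proof (rule ccontr)
  have zero: "count_list (\<sigma> [l]) k = 0" if "z $ k = 0" "z $ l \<noteq> 0" for k l
  proof -
    have "(\<Sum>l\<in>UNIV. real (count_list (\<sigma> [l]) k) * z $ l) = 0"
      using arg_cong[OF eig, of "\<lambda>x. x $ k"] that(1) by (simp add: matrix_vector_mult_def incidence_matrix_def)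
    then have "real (count_list (\<sigma> [l]) k) * z $ l = 0"
      using nonneg by (subst (asm) sum_nonneg_eq_0_iff) auto
    then show ?thesis using that(2) by simp
  qed
  assume "\<not> z $ k > 0"
  then have k: "z $ k = 0" using nonneg[of k] by simp
  obtain i j where ij: "i \<noteq> j" "i \<noteq> k" "j \<noteq> k" "UNIV = {i, j, k}" by (rule letters_other)
  have "z $ i \<noteq> 0 \<or> z $ j \<noteq> 0"
  proof (rule ccontr)
    assume "\<not> ?thesis"
    then have "z $ l = 0" for l using k ij(4) by (metis UNIV_I insertE singletonD)
    then show False using \<open>z \<noteq> 0\<close> by (simp add: vec_eq_iff)
  qed
  then show False
    using zero k ij(1-3) incidence_matrix_not_block_triangular[of i j k]
      incidence_matrix_not_block_triangular[of j i k] by metis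
qed

text \<open>If \<open>w\<close> is an eigenvector, the vector \<open>a\<close> of absolute values of its entries satisfies
  \<open>M a \<ge> \<beta> a\<close>, and pairing with the positive left eigenvector forces equality. Then \<open>a + w\<close> and
  \<open>a - w\<close> are nonnegative eigenvectors, each of them zero or positive; so \<open>w\<close> is zero or has entries of one strict
  sign, and the latter contradicts orthogonality to \<open>v\<close>. The same fact shows that the right eigenvector \<open>u\<close>
  is not orthogonal to \<open>v\<close>, so the projection along \<open>u\<close> makes sense.\<close>

lemma no_eigenvector_orthogonal:
  fixes v w :: "real ^ letter"
  assumes v: "transpose (incidence_matrix \<sigma>) *v v = \<beta> *s v" "\<And>i. v $ i > 0" and "\<beta> \<ge> 0"
    and w: "incidence_matrix \<sigma> *v w = \<beta> *s w" "w \<bullet> v = 0"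
  shows "w = 0"
proof -
  let ?M = "incidence_matrix \<sigma> :: real ^ letter ^ letter"
  define a :: "real ^ letter" where "a = (\<chi> i. \<bar>w $ i\<bar>)"
  have ge: "(?M *v a) $ i \<ge> \<beta> * a $ i" for i
  proof -
    have "\<beta> * a $ i = \<bar>(?M *v w) $ i\<bar>" using \<open>\<beta> \<ge> 0\<close> by (simp add: a_def w(1) abs_mult)
    also have "\<dots> \<le> (\<Sum>j\<in>UNIV. \<bar>?M $ i $ j * w $ j\<bar>)"
      unfolding matrix_vector_mult_def by simp
    also have "\<dots> = (?M *v a) $ i"
      by (simp add: matrix_vector_mult_def a_def abs_mult incidence_matrix_def)
    finally show ?thesis .
  qed
  have "v \<bullet> (?M *v a) = (transpose ?M *v v) \<bullet> a"
    by (simp add: dot_lmul_matrix)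
  also have "\<dots> = \<beta> * (v \<bullet> a)"
    using v(1) by (simp add: scalar_mult_eq_scaleR)
  finally have "(\<Sum>i\<in>UNIV. v $ i * ((?M *v a) $ i - \<beta> * a $ i)) = 0"
    by (simp add: inner_vec_def sum_subtractf right_diff_distrib sum_distrib_left algebra_simps)
  then have "v $ i * ((?M *v a) $ i - \<beta> * a $ i) = 0" for i
    using ge v(2) by (subst (asm) sum_nonneg_eq_0_iff) (auto simp: less_imp_le)
  then have a: "?M *v a = \<beta> *s a" using v(2) by (simp add: vec_eq_iff less_imp_neq[symmetric])
  have not_pos: False if "\<And>i. x $ i > 0" "x \<bullet> v = 0" for x
  proof -
    have "(\<Sum>i\<in>UNIV. x $ i * v $ i) > 0" using that v(2) by (intro sum_pos) auto
    then show False using that(2) by (simp add: inner_vec_def)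
  qed
  have *: "a + x = 0" if x: "?M *v x = \<beta> *s x" "x \<bullet> v = 0" "\<And>i. a $ i = \<bar>x $ i\<bar>" for x
  proof (rule ccontr)
    assume "a + x \<noteq> 0"
    have pos: "(a + x) $ i > 0" for i
    proof (rule nonneg_eigenvector_imp_pos[OF _ _ \<open>a + x \<noteq> 0\<close>])
      show "?M *v (a + x) = \<beta> *s (a + x)"
        using a x(1) by (simp add: matrix_vector_right_distrib vector_add_ldistrib)
    qed (simp add: x(3))
    have "x $ i > 0" for i using pos[of i] x(3)[of i] by (simp add: abs_if split: if_splits)
    then show False using not_pos x(2) by blast
  qed
  have neg: "?M *v (- w) = - (?M *v w)"
    using matrix_vector_mult_diff_distrib[of ?M 0 w] by simp
  have "a + w = 0" by (rule *) (simp_all add: w a_def)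
  moreover have "a + - w = 0"
    by (rule *) (simp_all add: w a_def neg)
  ultimately show ?thesis by (simp add: vec_eq_iff)
qed


lemma conjugate_modulus_less_1:
  assumes \<beta>: "pisot_number \<beta>" "poly (characteristic_poly (incidence_matrix \<sigma>)) \<beta> = 0"
    and z: "poly (characteristic_poly (incidence_matrix \<sigma>)) z = 0" "z \<noteq> complex_of_real \<beta>"
  shows "cmod z < 1"
proof -
  have "poly (characteristic_poly (incidence_matrix \<sigma>)) (complex_of_real \<beta>) = of_real (poly (characteristic_poly (incidence_matrix \<sigma>)) \<beta>)"
    by (simp add: characteristic_poly_3 second_coefficient_def trace_def sum_3 det_3 incidence_matrix_def)
  then have "conjugate_over_rat (complex_of_real \<beta>) z"
    unfolding conjugate_over_rat_def using \<beta>(2) z(1) irr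
    by (intro exI[of _ "characteristic_poly (incidence_matrix \<sigma>)"])
      (simp add: map_characteristic_poly_incidence_matrix)
  then show ?thesis using \<beta>(1) z(2) by (simp add: pisot_number_def)
qed

text \<open>The characteristic polynomial factors as \<open>(X - \<beta>) (X\<^sup>2 - a X + b)\<close>. On the contracting plane
  \<open>M - \<beta>\<close> is injective, so Cayley-Hamilton leaves the quadratic factor. Its roots \<open>x\<close> and \<open>y\<close> are conjugates
  of \<open>\<beta>\<close>, and differ from it because \<open>\<beta>\<close> is a simple root.\<close>

lemma contracting_plane_recurrence:
  fixes v :: "real ^ letter"
  assumes \<beta>: "pisot_number \<beta>" "poly (characteristic_poly (incidence_matrix \<sigma>)) \<beta> = 0"
    and v: "transpose (incidence_matrix \<sigma>) *v v = \<beta> *s v" "\<And>i. v $ i > 0"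
  obtains a b :: real and x y :: complex
  where "x + y = of_real a" "x * y = of_real b" "cmod x < 1" "cmod y < 1"
    "\<And>w. w \<bullet> v = 0 \<Longrightarrow> incidence_matrix \<sigma> *v (incidence_matrix \<sigma> *v w) = a *\<^sub>R (incidence_matrix \<sigma> *v w) - b *\<^sub>R w"
proof -
  let ?M = "incidence_matrix \<sigma> :: real ^ letter ^ letter"
  let ?C = "incidence_matrix \<sigma> :: complex ^ letter ^ letter"
  define a where "a = trace ?M - \<beta>"
  define b where "b = second_coefficient ?M - a * \<beta>"
  have d: "det ?M = b * \<beta>"
    using \<beta>(2) by (simp add: characteristic_poly_3 a_def b_def algebra_simps)
  have C: "trace ?C = of_real (trace ?M)" "det ?C = of_real (det ?M)"
    "second_coefficient ?C = of_real (second_coefficient ?M)"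
    by (simp_all add: second_coefficient_def trace_def sum_3 det_3 incidence_matrix_def)
  have tr: "trace ?M = a + \<beta>" and sc: "second_coefficient ?M = b + a * \<beta>" by (simp_all add: a_def b_def)
  have factor: "characteristic_poly ?C = [:- of_real \<beta>, 1:] * [:of_real b, - of_real a, 1:]"
    by (simp add: characteristic_poly_3 C d tr sc algebra_simps)
  define s where "s = csqrt (of_real (a\<^sup>2 - 4 * b))"
  define x y where "x = (of_real a + s) / 2" and "y = (of_real a - s) / 2"
  have s: "s * s = of_real a * of_real a - 4 * of_real b"
    using power2_csqrt[of "of_real (a\<^sup>2 - 4 * b)"] by (simp add: s_def power2_eq_square)
  have xy: "x + y = of_real a" "x * y = of_real b"
    using s by (simp_all add: x_def y_def field_simps)
  have mod: "cmod z < 1" if z: "z * z - of_real a * z + of_real b = 0" for z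
  proof (rule conjugate_modulus_less_1[OF \<beta>])
    have q: "poly [:of_real b, - of_real a, 1:] z = 0" using z by (simp add: algebra_simps)
    then show "poly (characteristic_poly ?C) z = 0" unfolding factor poly_mult by simp
    show "z \<noteq> of_real \<beta>"
    proof
      assume "z = of_real \<beta>"
      then have "poly (pderiv (characteristic_poly ?C)) z = 0"
        using q unfolding factor pderiv_mult by (simp add: pderiv_pCons algebra_simps)
      then show False
        using characteristic_poly_simple_root[of z] \<open>poly (characteristic_poly ?C) z = 0\<close> by blast
    qed
  qed
  have "cmod x < 1" "cmod y < 1"
    by (rule mod, unfold xy[symmetric], simp add: algebra_simps)+
  moreover have "?M *v (?M *v w) = a *\<^sub>R (?M *v w) - b *\<^sub>R w" if w: "w \<bullet> v = 0" for w
  proof -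
    define z where "z = ?M *v (?M *v w) - a *\<^sub>R (?M *v w) + b *\<^sub>R w"
    have inv: "(?M *v x) \<bullet> v = \<beta> * (x \<bullet> v)" for x
      using dot_lmul_matrix[of v ?M x] v(1) by (simp add: inner_commute scalar_mult_eq_scaleR)
    have "z = 0"
    proof (rule no_eigenvector_orthogonal[OF v])
      show "\<beta> \<ge> 0" using \<beta>(1) by (simp add: pisot_number_def)
      show "?M *v z = \<beta> *s z"
        using cayley_hamilton_3[of ?M w]
        by (simp add: z_def tr sc d scalar_mult_eq_scaleR matrix_vector_right_distrib
            matrix_vector_mult_diff_distrib matrix_vector_mult_scaleR algebra_simps)
      show "z \<bullet> v = 0"
        by (simp add: z_def inner_diff_left inner_add_left inv w)
    qed
    then show ?thesis by (simp add: z_def algebra_simps)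
  qed
  ultimately show ?thesis using that[OF xy] by blast
qed

end

text \<open>The sequence \<open>f (n + 1) - y f n\<close> is geometric with ratio \<open>x\<close>, which turns the recurrence into one of
  first order with ratio \<open>y\<close>. Passing from \<open>q\<close> to a larger \<open>r\<close> absorbs the resonance in the case \<open>x = y\<close>.\<close>

lemma linear_recurrence_decay:
  fixes f :: "nat \<Rightarrow> real" and x y :: complex
  assumes rec: "\<And>n. f (Suc (Suc n)) = a * f (Suc n) - b * f n"
    and xy: "x + y = of_real a" "x * y = of_real b" "cmod x \<le> q" "cmod y \<le> q" and "q < r" "r < 1"
  shows "\<bar>f n\<bar> \<le> (\<bar>f 0\<bar> + (\<bar>f 1\<bar> + \<bar>f 0\<bar>) / (r - q)) * r ^ n"
proof -
  have q: "q \<ge> 0" using norm_ge_zero xy(3) order_trans by blast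
  define g where "g n = of_real (f (Suc n)) - y * of_real (f n)" for n
  have "g (Suc n) = x * g n" for n
  proof -
    have "g (Suc n) = (x + y) * of_real (f (Suc n)) - x * y * of_real (f n) - y * of_real (f (Suc n))"
      by (simp add: g_def rec xy(1,2))
    then show ?thesis by (simp add: g_def algebra_simps)
  qed
  then have g: "g n = x ^ n * g 0" for n by (induction n) auto
  define G where "G = \<bar>f 1\<bar> + \<bar>f 0\<bar>"
  have g0: "cmod (g 0) \<le> G"
  proof -
    have "cmod (g 0) \<le> \<bar>f 1\<bar> + cmod y * \<bar>f 0\<bar>"
      using norm_triangle_ineq4[of "of_real (f 1)" "y * of_real (f 0)"] by (simp add: g_def norm_mult)
    also have "cmod y * \<bar>f 0\<bar> \<le> 1 * \<bar>f 0\<bar>"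
      using assms by (intro mult_right_mono) auto
    finally show ?thesis by (simp add: G_def)
  qed
  have gn: "cmod (g n) \<le> q ^ n * G" for n
    unfolding g[of n] norm_mult norm_power using xy(3) q g0 by (intro mult_mono power_mono) auto
  define K where "K = \<bar>f 0\<bar> + G / (r - q)"
  have "G \<ge> 0" by (simp add: G_def)
  have "K * (r - q) = \<bar>f 0\<bar> * (r - q) + G"
    using \<open>q < r\<close> by (simp add: K_def distrib_right)
  then have K: "K * (r - q) \<ge> G" "K \<ge> 0"
    using \<open>q < r\<close> \<open>G \<ge> 0\<close> by (auto simp: K_def)
  have "\<bar>f n\<bar> \<le> K * r ^ n"
  proof (induction n)
    case 0
    then show ?case using \<open>q < r\<close> \<open>G \<ge> 0\<close> by (simp add: K_def)
  next
    case (Suc n)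
    have "\<bar>f (Suc n)\<bar> = cmod (y * of_real (f n) + g n)"
      by (simp add: g_def)
    also have "\<dots> \<le> cmod y * \<bar>f n\<bar> + cmod (g n)"
      using norm_triangle_ineq[of "y * of_real (f n)" "g n"] by (simp add: norm_mult)
    also have "\<dots> \<le> q * (K * r ^ n) + r ^ n * G"
    proof (intro add_mono mult_mono)
      have "q ^ n * G \<le> r ^ n * G"
        using q \<open>q < r\<close> \<open>G \<ge> 0\<close> by (intro mult_right_mono power_mono) auto
      then show "cmod (g n) \<le> r ^ n * G" using gn[of n] by linarith
    qed (use Suc xy q in auto)
    also have "\<dots> \<le> q * (K * r ^ n) + r ^ n * (K * (r - q))"
      using K q \<open>q < r\<close> by (intro add_left_mono mult_left_mono) auto
    also have "\<dots> = K * r ^ Suc n" by (simp add: algebra_simps)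
    finally show ?case .
  qed
  then show ?thesis by (simp add: K_def G_def)
qed

lemma contracting_plane_decay:
  fixes v :: "real ^ letter"
  assumes irr: "irreducible (characteristic_poly (incidence_matrix \<sigma> :: rat ^ letter ^ letter))"
    and \<beta>: "pisot_number \<beta>" "poly (characteristic_poly (incidence_matrix \<sigma>)) \<beta> = 0"
    and v: "transpose (incidence_matrix \<sigma>) *v v = \<beta> *s v" "\<And>i. v $ i > 0"
  obtains K r where "0 \<le> r" "r < 1" "0 \<le> K"
    "\<And>w n. w \<bullet> v = 0 \<Longrightarrow> norm (((*v) (incidence_matrix \<sigma>) ^^ n) w) \<le> K * r ^ n * norm w"
proof -
  let ?M = "incidence_matrix \<sigma> :: real ^ letter ^ letter"
  obtain a b x y where ab: "x + y = of_real a" "x * y = of_real b" "cmod x < 1" "cmod y < 1"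
    "\<And>w. w \<bullet> v = 0 \<Longrightarrow> ?M *v (?M *v w) = a *\<^sub>R (?M *v w) - b *\<^sub>R w"
    by (rule contracting_plane_recurrence[OF irr \<beta> v]) blast
  define q where "q = max (cmod x) (cmod y)"
  have q: "cmod x \<le> q" "cmod y \<le> q" "q < 1" using ab by (auto simp: q_def)
  obtain r where r: "q < r" "r < 1" using dense[OF q(3)] by blast
  have "q \<ge> 0" using q(1) norm_ge_zero order_trans by blast
  define B where "B = onorm ((*v) ?M)"
  have bl: "bounded_linear ((*v) ?M)" by (simp add: matrix_vector_mul_bounded_linear)
  then have B: "norm (?M *v w) \<le> B * norm w" "B \<ge> 0" for w
    unfolding B_def by (auto intro: onorm onorm_pos_le)
  define K where "K = 3 * (1 + (B + 1) / (r - q))"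
  have "norm (((*v) ?M ^^ n) w) \<le> K * r ^ n * norm w" if w: "w \<bullet> v = 0" for w n
  proof -
    have plane: "(((*v) ?M ^^ n) w) \<bullet> v = 0" for n
    proof (induction n)
      case (Suc n)
      then show ?case
        using dot_lmul_matrix[of v ?M "((*v) ?M ^^ n) w"] v(1)
        by (simp add: inner_commute scalar_mult_eq_scaleR)
    qed (simp add: w)
    have comp: "\<bar>(((*v) ?M ^^ n) w) $ i\<bar> \<le> (1 + (B + 1) / (r - q)) * norm w * r ^ n" for i
    proof -
      have "\<bar>(((*v) ?M ^^ n) w) $ i\<bar> \<le>
          (\<bar>(((*v) ?M ^^ 0) w) $ i\<bar> + (\<bar>(((*v) ?M ^^ 1) w) $ i\<bar> + \<bar>(((*v) ?M ^^ 0) w) $ i\<bar>) / (r - q)) * r ^ n"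
        by (rule linear_recurrence_decay[of "\<lambda>n. (((*v) ?M ^^ n) w) $ i", OF _ ab(1,2) q(1,2) r])
          (simp add: ab(5)[OF plane])
      also have "\<dots> \<le> (norm w + (B * norm w + norm w) / (r - q)) * r ^ n"
        using r \<open>q \<ge> 0\<close> component_le_norm_cart[of w i] component_le_norm_cart[of "?M *v w" i] B(1)[of w]
        by (intro mult_right_mono add_mono divide_right_mono) auto
      also have "\<dots> = (1 + (B + 1) / (r - q)) * norm w * r ^ n"
        by (simp add: algebra_simps add_divide_distrib)
      finally show ?thesis .
    qed
    have "norm (((*v) ?M ^^ n) w) \<le> (\<Sum>i\<in>UNIV. \<bar>(((*v) ?M ^^ n) w) $ i\<bar>)"
      by (rule norm_le_l1_cart)
    also have "\<dots> \<le> (\<Sum>i\<in>(UNIV :: letter set). (1 + (B + 1) / (r - q)) * norm w * r ^ n)"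
      by (intro sum_mono comp)
    also have "\<dots> = K * r ^ n * norm w" by (simp add: K_def)
    finally show ?thesis .
  qed
  moreover have "0 \<le> K" "0 \<le> r"
    using r \<open>q \<ge> 0\<close> B(2) by (auto simp: K_def)
  ultimately show ?thesis using r(2) that by blast
qed

section \<open>Hausdorff limits\<close>

lemma infdist_le_hausdorff_distance:
  fixes A B :: "'a::metric_space set"
  assumes "bounded A" "bounded B" "A \<noteq> {}" "B \<noteq> {}"
  shows "a \<in> A \<Longrightarrow> infdist a B \<le> hausdorff_distance A B"
    and "b \<in> B \<Longrightarrow> infdist b A \<le> hausdorff_distance A B"
proof -
  have bdd: "bdd_above ((\<lambda>x. infdist x T) ` S)" if S: "bounded S" and T: "T \<noteq> {}" for S T :: "'a set"
  proof -
    obtain t where t: "t \<in> T" using T by blast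
    obtain e where "\<forall>y\<in>S. dist t y \<le> e" using S bounded_any_center[of S t] by blast
    then show ?thesis
      using t by (intro bdd_aboveI2[of _ _ e]) (metis dist_commute infdist_le order_trans)
  qed
  show "a \<in> A \<Longrightarrow> infdist a B \<le> hausdorff_distance A B"
    unfolding hausdorff_distance_def
    by (rule max.coboundedI1, rule cSUP_upper) (use bdd assms in auto)
  show "b \<in> B \<Longrightarrow> infdist b A \<le> hausdorff_distance A B"
    unfolding hausdorff_distance_def
    by (rule max.coboundedI2, rule cSUP_upper) (use bdd assms in auto)
qed

lemma infdist_lessD:
  assumes "infdist x A < e" "A \<noteq> {}"
  shows "\<exists>a\<in>A. dist x a < e"
  using assms cInf_lessD[of "dist x ` A" e] unfolding infdist_def by auto

lemma hausdorff_distance_tendsto_0_imp_near: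
  fixes D :: "nat \<Rightarrow> 'a::metric_space set"
  assumes lim: "(\<lambda>n. hausdorff_distance (D n) R) \<longlonglongrightarrow> 0"
    and D: "\<And>n. bounded (D n)" "\<And>n. D n \<noteq> {}" and R: "bounded R" "R \<noteq> {}" and "e > 0"
  shows "\<exists>n. (\<forall>x\<in>D n. \<exists>y\<in>R. dist x y < e) \<and> (\<forall>y\<in>R. \<exists>x\<in>D n. dist y x < e)"
proof -
  have "eventually (\<lambda>n. hausdorff_distance (D n) R < e) sequentially"
    using lim \<open>e > 0\<close> by (rule order_tendstoD)
  then obtain n where "hausdorff_distance (D n) R < e"
    by (auto simp: eventually_sequentially)
  then have "\<And>x. x \<in> D n \<Longrightarrow> infdist x R < e" "\<And>y. y \<in> R \<Longrightarrow> infdist y (D n) < e"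
    using infdist_le_hausdorff_distance[OF D(1) R(1) D(2) R(2), of _ n] by fastforce+
  then show ?thesis
    using infdist_lessD[OF _ R(2)] infdist_lessD[OF _ D(2)] by blast
qed

text \<open>A separation of \<open>R\<close> would consist of two compact sets at positive distance \<open>d\<close>; a set \<open>D n\<close> within
  \<open>d / 2\<close> of \<open>R\<close> would then be separated by their neighbourhoods of radius \<open>d / 2\<close>.\<close>

lemma hausdorff_limit_connected:
  fixes D :: "nat \<Rightarrow> 'a::heine_borel set"
  assumes lim: "(\<lambda>n. hausdorff_distance (D n) R) \<longlonglongrightarrow> 0"
    and D: "\<And>n. bounded (D n)" "\<And>n. D n \<noteq> {}" "\<And>n. connected (D n)"
    and R: "compact R" "R \<noteq> {}"
  shows "connected R"
proof (rule ccontr)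
  assume "\<not> connected R"
  then obtain S T where ST: "closed S" "closed T" "R \<subseteq> S \<union> T" "S \<inter> T \<inter> R = {}"
      "S \<inter> R \<noteq> {}" "T \<inter> R \<noteq> {}"
    unfolding connected_closed by blast
  define A B where "A = R \<inter> S" and "B = R \<inter> T"
  have AB: "compact A" "closed B" "A \<inter> B = {}" "A \<noteq> {}" "B \<noteq> {}" "R = A \<union> B"
    using ST R(1) by (auto simp: A_def B_def compact_Int_closed compact_imp_closed)
  then obtain d where d: "d > 0" "\<And>x y. x \<in> A \<Longrightarrow> y \<in> B \<Longrightarrow> d \<le> dist x y"
    using separate_compact_closed[of A B] by blast
  obtain n where n: "\<And>x. x \<in> D n \<Longrightarrow> \<exists>y\<in>R. dist x y < d/2" "\<And>y. y \<in> R \<Longrightarrow> \<exists>x\<in>D n. dist y x < d/2"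
    using hausdorff_distance_tendsto_0_imp_near[OF lim D(1,2) _ R(2), of "d/2"] d(1) R(1)
    by (force dest: compact_imp_bounded)
  define V W where "V = (\<Union>a\<in>A. ball a (d/2))" and "W = (\<Union>b\<in>B. ball b (d/2))"
  have "open V" "open W" by (auto simp: V_def W_def)
  moreover have "D n \<subseteq> V \<union> W"
    using n(1) AB(6) by (fastforce simp: V_def W_def dist_commute)
  moreover have "V \<inter> W \<inter> D n = {}"
  proof -
    have False if "a \<in> A" "b \<in> B" "dist a x < d/2" "dist b x < d/2" for a b x
      using that d(2)[of a b] dist_triangle2[of a b x] by linarith
    then show ?thesis by (auto simp: V_def W_def)
  qed
  moreover have "V \<inter> D n \<noteq> {}" "W \<inter> D n \<noteq> {}"
  proof -
    obtain a b where ab: "a \<in> A" "b \<in> B" using AB(4,5) by blast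
    obtain x y where "x \<in> D n" "dist a x < d/2" "y \<in> D n" "dist b y < d/2"
      using n(2)[of a] n(2)[of b] ab AB(6) by auto
    then show "V \<inter> D n \<noteq> {}" "W \<inter> D n \<noteq> {}"
      using ab unfolding V_def W_def mem_ball[symmetric] by blast+
  qed
  ultimately show False
    using D(3)[of n] unfolding connected_def by blast
qed

lemma hausdorff_limit_unique:
  fixes D :: "nat \<Rightarrow> 'a::metric_space set"
  assumes D: "\<And>n. bounded (D n)" "\<And>n. D n \<noteq> {}"
    and R: "compact R" "R \<noteq> {}" "(\<lambda>n. hausdorff_distance (D n) R) \<longlonglongrightarrow> 0"
    and S: "compact S" "S \<noteq> {}" "(\<lambda>n. hausdorff_distance (D n) S) \<longlonglongrightarrow> 0"
  shows "R = S"
proof -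
  have *: "x \<in> T'" if "x \<in> T" "compact T" "T \<noteq> {}" and lim: "(\<lambda>n. hausdorff_distance (D n) T) \<longlonglongrightarrow> 0"
      and "compact T'" "T' \<noteq> {}" and lim': "(\<lambda>n. hausdorff_distance (D n) T') \<longlonglongrightarrow> 0" for x T T'
  proof -
    have "infdist x T' \<le> 0 + e" if "e > 0" for e
    proof -
      have ev: "eventually (\<lambda>n. hausdorff_distance (D n) T < e/2) sequentially"
        "eventually (\<lambda>n. hausdorff_distance (D n) T' < e/2) sequentially"
        using order_tendstoD(2)[OF lim, of "e/2"] order_tendstoD(2)[OF lim', of "e/2"] \<open>e > 0\<close> by simp_all
      obtain n where n: "hausdorff_distance (D n) T < e/2" "hausdorff_distance (D n) T' < e/2"
        using eventually_happens[OF eventually_conj[OF ev]] by auto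
      have "infdist x (D n) < e/2"
        using infdist_le_hausdorff_distance(2)[OF D(1) _ D(2) \<open>T \<noteq> {}\<close> \<open>x \<in> T\<close>, of n] n(1) \<open>compact T\<close>
        by (meson compact_imp_bounded le_less_trans)
      then obtain y where y: "y \<in> D n" "dist x y < e/2"
        using infdist_lessD D(2) by blast
      have "infdist y T' < e/2"
        using infdist_le_hausdorff_distance(1)[OF D(1) _ D(2) \<open>T' \<noteq> {}\<close> y(1)] n(2) \<open>compact T'\<close>
        by (meson compact_imp_bounded le_less_trans)
      then show ?thesis using infdist_triangle[of x T' y] y(2) by linarith
    qed
    then have "infdist x T' \<le> 0" by (rule field_le_epsilon)
    then have "infdist x T' = 0" using infdist_nonneg[of x T'] by linarith
    then show ?thesis
      using in_closed_iff_infdist_zero[of T' x] that by (simp add: compact_imp_closed)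
  qed
  show ?thesis using *[OF _ R S] *[OF _ S R] by blast
qed

text \<open>A Cauchy criterion. With \<open>t n\<close> the tail of the series of the \<open>\<delta> k\<close>, the limit is the set of the points
  at distance at most \<open>t n\<close> from \<open>D n\<close> for every \<open>n\<close>. Conversely a point of \<open>D n\<close> is within \<open>t n\<close> of the
  limit: following it forward through the sets \<open>D (n + k)\<close> gives a Cauchy sequence, and following it
  backward shows that the limit point is close enough to the earlier sets too.\<close>

lemma hausdorff_limit_exists:
  fixes D :: "nat \<Rightarrow> 'a::heine_borel set"
  assumes D: "\<And>n. bounded (D n)" "\<And>n. D n \<noteq> {}" "\<And>n. D n \<subseteq> S" and S: "closed S"
    and smb: "summable \<delta>" and pos: "\<And>n. \<delta> n \<ge> (0::real)"
    and fwd: "\<And>n x. x \<in> D n \<Longrightarrow> \<exists>y\<in>D (Suc n). dist x y \<le> \<delta> n"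
    and bwd: "\<And>n y. y \<in> D (Suc n) \<Longrightarrow> \<exists>x\<in>D n. dist x y \<le> \<delta> n"
  shows "\<exists>R. compact R \<and> R \<noteq> {} \<and> R \<subseteq> S \<and> (\<lambda>n. hausdorff_distance (D n) R) \<longlonglongrightarrow> 0"
proof -
  define t where "t n = (\<Sum>k. \<delta> (k + n))" for n
  have t_Suc: "t n = \<delta> n + t (Suc n)" for n
    using suminf_split_head[of "\<lambda>k. \<delta> (k + n)"] smb by (simp add: t_def)
  have t_nonneg: "t n \<ge> 0" for n
    unfolding t_def by (intro suminf_nonneg) (simp_all add: pos smb )
  have t_lim: "t \<longlonglongrightarrow> 0"
    using suminf_exist_split2[OF smb] by (simp add: t_def[abs_def])
  define R where "R = S \<inter> (\<Inter>n. {x. infdist x (D n) \<le> t n})"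
  have R_near: "infdist x (D n) \<le> t n" if "x \<in> R" for x n using that by (auto simp: R_def)
  have near_R: "\<exists>y\<in>R. dist x y \<le> t n" if x: "x \<in> D n" for x n
  proof -
    have "\<exists>f. \<forall>k. f k \<in> D (n + k) \<and> dist (f k) (f (Suc k)) \<le> \<delta> (n + k) \<and> (k = 0 \<longrightarrow> f k = x)"
    proof -
      have "\<exists>f. \<forall>k. (f k \<in> D (n + k) \<and> (k = 0 \<longrightarrow> f k = x)) \<and> dist (f k) (f (Suc k)) \<le> \<delta> (n + k)"
        by (rule dependent_nat_choice) (use x fwd in auto)
      then show ?thesis by blast
    qed
    then obtain f where f: "\<And>k. f k \<in> D (n + k)" "\<And>k. dist (f k) (f (Suc k)) \<le> \<delta> (n + k)" "f 0 = x"
      by blast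
    have step: "dist (f k) (f (k + m)) \<le> t (n + k) - t (n + k + m)" for k m
    proof (induction m)
      case (Suc m)
      then show ?case
        using dist_triangle[of "f k" "f (k + Suc m)" "f (k + m)"] f(2)[of "k + m"] t_Suc[of "n + k + m"]
        by (simp add: add.assoc)
    qed simp
    have step': "dist (f k) (f (k + m)) \<le> t (n + k)" for k m
      using step[of k m] t_nonneg[of "n + k + m"] by linarith
    have "Cauchy f"
    proof (rule metric_CauchyI)
      fix e :: real assume "e > 0"
      have "eventually (\<lambda>k. t k < e / 2) sequentially"
        using t_lim \<open>e > 0\<close> by (intro order_tendstoD) auto
      then obtain N where N: "\<And>k. k \<ge> N \<Longrightarrow> t k < e / 2" by (auto simp: eventually_sequentially)
      have "dist (f N) (f k) < e / 2" if "k \<ge> N" for k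
        using step'[of N "k - N"] N[of "n + N"] that by simp
      then have "dist (f k) (f l) < e" if "k \<ge> N" "l \<ge> N" for k l
        using that dist_triangle_half_r by blast
      then show "\<exists>M. \<forall>m\<ge>M. \<forall>n\<ge>M. dist (f m) (f n) < e" by blast
    qed
    then obtain y where y: "f \<longlonglongrightarrow> y" using Cauchy_convergent_iff convergent_def by blast
    \<comment> \<open>Going back from D (k + m) to D k costs only the part of the series between k and k + m.\<close>
    have descend: "\<exists>z\<in>D k. dist z w \<le> t k - t (k + m)" if "w \<in> D (k + m)" for k m w
      using that
    proof (induction m arbitrary: w)
      case (Suc m)
      then obtain w' where w': "w' \<in> D (k + m)" "dist w' w \<le> \<delta> (k + m)"
        using bwd[of w "k + m"] by auto
      obtain z where z: "z \<in> D k" "dist z w' \<le> t k - t (k + m)" using Suc.IH[OF w'(1)] by blast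
      show ?case
        using z w' dist_triangle[of z w w'] t_Suc[of "k + m"] by (intro bexI[of _ z]) auto
    qed auto
    have dist_y: "dist (f k) y \<le> t (n + k)" for k
    proof (rule tendsto_upperbound)
      show "(\<lambda>m. dist (f k) (f (m + k))) \<longlonglongrightarrow> dist (f k) y"
        by (intro tendsto_intros LIMSEQ_ignore_initial_segment y)
      show "\<forall>\<^sub>F m in sequentially. dist (f k) (f (m + k)) \<le> t (n + k)"
        using step'[of k] by (simp add: add.commute)
    qed simp
    have "infdist y (D k) \<le> t k" for k
    proof (cases "k \<ge> n")
      case True
      then show ?thesis
        using dist_y[of "k - n"] f(1)[of "k - n"] infdist_le2[of "f (k - n)" "D k" y "t k"]
        by (simp add: dist_commute)
    next
      case False
      then obtain m where m: "n = k + m" by (metis le_add_diff_inverse nat_le_linear)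
      obtain z where z: "z \<in> D k" "dist z x \<le> t k - t n" using descend[of x k m] x m by auto
      have "dist y z \<le> t k"
        using z(2) dist_y[of 0] f(3) dist_triangle[of z y x] by (simp add: dist_commute)
      then show ?thesis using z(1) infdist_le2 by blast
    qed
    moreover have "y \<in> S"
      using closed_sequentially[OF S _ y] f(1) D(3) by blast
    ultimately have "y \<in> R" by (simp add: R_def)
    then show ?thesis using dist_y[of 0] f(3) by auto
  qed
  have "R \<noteq> {}" using near_R D(2) by blast
  have "closed R"
    unfolding R_def
    by (intro closed_Int S closed_INT ballI closed_Collect_le continuous_intros)
  moreover have "bounded R"
  proof -
    obtain c e where ce: "\<And>x. x \<in> D 0 \<Longrightarrow> dist c x \<le> e"
      using D(1)[of 0] unfolding bounded_def by blast
    have "dist c x \<le> e + (t 0 + 1)" if "x \<in> R" for x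
    proof -
      have "infdist x (D 0) < t 0 + 1" using R_near[OF that, of 0] by linarith
      then obtain z where "z \<in> D 0" "dist x z < t 0 + 1" using infdist_lessD D(2) by blast
      then show ?thesis using ce[of z] dist_triangle[of c x z] by (simp add: dist_commute)
    qed
    then show ?thesis unfolding bounded_def by blast
  qed
  ultimately have "compact R" by (simp add: compact_eq_bounded_closed)
  moreover have "R \<subseteq> S" by (auto simp: R_def)
  moreover have "(\<lambda>n. hausdorff_distance (D n) R) \<longlonglongrightarrow> 0"
  proof (rule tendsto_sandwich[OF _ _ tendsto_const t_lim])
    have "hausdorff_distance (D n) R \<le> t n" for n
      unfolding hausdorff_distance_def
      by (intro max.boundedI cSUP_least D \<open>R \<noteq> {}\<close> R_near) (use near_R infdist_le2 in blast)+
    then show "\<forall>\<^sub>F n in sequentially. hausdorff_distance (D n) R \<le> t n" by simp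
    have "0 \<le> hausdorff_distance (D n) R" for n
    proof -
      obtain x where "x \<in> D n" using D(2) by blast
      then have "infdist x R \<le> hausdorff_distance (D n) R"
        using infdist_le_hausdorff_distance(1)[OF D(1) compact_imp_bounded D(2) \<open>R \<noteq> {}\<close>] \<open>compact R\<close> by blast
      then show ?thesis using infdist_nonneg order_trans by blast
    qed
    then show "\<forall>\<^sub>F n in sequentially. 0 \<le> hausdorff_distance (D n) R" by simp
  qed
  ultimately show ?thesis using \<open>R \<noteq> {}\<close> by blast
qed

section \<open>Convergence to the Rauzy fractal\<close>

lemma maximal_eigenvalue_unique:
  assumes "maximal_eigenvalue \<sigma> \<beta>" "maximal_eigenvalue \<sigma> \<gamma>"
  shows "\<beta> = \<gamma>"
proof -
  have "cmod (of_real \<beta>) \<le> \<beta>" "cmod (of_real \<beta>) \<le> \<gamma>" "cmod (of_real \<gamma>) \<le> \<gamma>" "cmod (of_real \<gamma>) \<le> \<beta>"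
    using assms unfolding maximal_eigenvalue_def by blast+
  then show ?thesis by simp
qed

lemma real_point_add: "real_point (x + y) = real_point x + real_point y"
  by (simp add: real_point_def vec_eq_iff)

lemma real_point_incidence_matrix_mult:
  "real_point (incidence_matrix \<sigma> *v x) = incidence_matrix \<sigma> *v real_point x"
  by (simp add: real_point_def vec_eq_iff matrix_vector_mult_def incidence_matrix_def)

lemma norm_unit_face_diff: "a \<in> unit_face (x, i) \<Longrightarrow> norm (a - real_point x) \<le> 3"
proof -
  assume a: "a \<in> unit_face (x, i)"
  have "\<bar>(a - real_point x) $ l\<bar> \<le> 1" for l
    using a by (cases "l = i") (auto simp: unit_face_eq real_point_def abs_le_iff)
  then have "(\<Sum>l\<in>UNIV. \<bar>(a - real_point x) $ l\<bar>) \<le> (\<Sum>l\<in>(UNIV :: letter set). 1)"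
    by (intro sum_mono)
  then show ?thesis using norm_le_l1_cart[of "a - real_point x"] by simp
qed

lemma norm_abelianization: "norm (real_point (abelianization s)) \<le> 3 * real (length s)"
proof -
  have "(\<Sum>l\<in>UNIV. \<bar>real_point (abelianization s) $ l\<bar>) \<le> (\<Sum>l\<in>(UNIV :: letter set). real (length s))"
    by (intro sum_mono) (simp add: real_point_def abelianization_def count_le_length)
  then show ?thesis using norm_le_l1_cart[of "real_point (abelianization s)"] by simp
qed

text \<open>The base point \<open>y\<close> of a face in the image of a face at \<open>x\<close> satisfies \<open>M y = x + P s\<close> for one of
  finitely many words \<open>s\<close>, so \<open>M\<close> brings the new faces back to bounded distance from the old one.\<close>

lemma dual_subst_face_near:
  assumes "invertible (incidence_matrix \<sigma> :: int ^ letter ^ letter)"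
  obtains C where "C \<ge> 0" "\<And>f g a b. g \<in> dual_subst_face \<sigma> f \<Longrightarrow> a \<in> unit_face f \<Longrightarrow> b \<in> unit_face g \<Longrightarrow>
    norm (incidence_matrix \<sigma> *v b - a) \<le> C"
proof -
  let ?M = "incidence_matrix \<sigma> :: real ^ letter ^ letter"
  define B where "B = onorm ((*v) ?M)"
  have B: "norm (?M *v w) \<le> B * norm w" "B \<ge> 0" for w
    unfolding B_def by (auto intro: onorm onorm_pos_le matrix_vector_mul_bounded_linear)
  define L where "L = (\<Sum>j\<in>UNIV. length (\<sigma> [j]))"
  have "norm (?M *v b - a) \<le> B * 3 + 3 * real L + 3"
    if g: "g \<in> dual_subst_face \<sigma> f" and a: "a \<in> unit_face f" and b: "b \<in> unit_face g" for f g a b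
  proof -
    obtain x i y j where fg: "f = (x, i)" "g = (y, j)" by (cases f; cases g)
    obtain p s where s: "\<sigma> [j] = p @ [i] @ s" "incidence_matrix \<sigma> *v y = x + abelianization s"
      using g unfolding fg mem_dual_subst_face_iff[OF assms] by blast
    have "length s \<le> length (\<sigma> [j])" using s(1) by simp
    also have "\<dots> \<le> L" unfolding L_def by (rule member_le_sum) auto
    finally have "norm (real_point (abelianization s)) \<le> 3 * real L"
      using norm_abelianization[of s] by linarith
    moreover have eq: "?M *v b - a = ?M *v (b - real_point y) + real_point (abelianization s) - (a - real_point x)"
      using arg_cong[OF s(2), of real_point]
      by (simp add: real_point_incidence_matrix_mult real_point_add matrix_vector_mult_diff_distrib)
    moreover have "norm (?M *v (b - real_point y)) \<le> B * 3"
      using B(1)[of "b - real_point y"] B(2) norm_unit_face_diff b unfolding fg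
      by (meson mult_left_mono order_trans)
    moreover have "norm (a - real_point x) \<le> 3" using norm_unit_face_diff a unfolding fg by blast
    ultimately show ?thesis
      unfolding eq
      using norm_triangle_ineq[of "?M *v (b - real_point y)" "real_point (abelianization s)"]
        norm_triangle_ineq4[of "?M *v (b - real_point y) + real_point (abelianization s)" "a - real_point x"]
      by linarith
  qed
  moreover have "B * 3 + 3 * real L + 3 \<ge> 0" using B(2) by simp
  ultimately show ?thesis using that by blast
qed

text \<open>Since \<open>M\<close> commutes with the projection, the displacement between \<open>M\<^sup>n \<pi> a\<close> and
  \<open>M\<^sup>n\<^sup>+\<^sup>1 \<pi> b\<close> is \<open>M\<^sup>n\<close> applied to the projection of \<open>M b - a\<close>: a bounded vector of
  the contracting plane, which \<open>M\<^sup>n\<close> shrinks geometrically.\<close>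

lemma rauzy_approx_step:
  fixes u v :: "real ^ letter"
  assumes inv: "invertible (incidence_matrix \<sigma> :: int ^ letter ^ letter)"
    and ne: "\<And>f. dual_subst_face \<sigma> f \<noteq> {}"
    and u: "incidence_matrix \<sigma> *v u = \<beta> *s u" and v: "transpose (incidence_matrix \<sigma>) *v v = \<beta> *s v"
    and uv: "u \<bullet> v \<noteq> 0" and "0 \<le> K"
    and decay: "\<And>w n. w \<bullet> v = 0 \<Longrightarrow> norm (((*v) (incidence_matrix \<sigma>) ^^ n) w) \<le> K * r ^ n * norm w"
    and r: "0 \<le> r"
  obtains C where "C \<ge> 0"
    "\<And>n x. x \<in> rauzy_approx \<sigma> u v n \<Longrightarrow> \<exists>y\<in>rauzy_approx \<sigma> u v (Suc n). dist x y \<le> C * r ^ n"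
    "\<And>n y. y \<in> rauzy_approx \<sigma> u v (Suc n) \<Longrightarrow> \<exists>x\<in>rauzy_approx \<sigma> u v n. dist x y \<le> C * r ^ n"
proof -
  let ?M = "incidence_matrix \<sigma> :: real ^ letter ^ letter" and ?\<pi> = "contracting_projection u v"
  let ?F = "\<lambda>n. (dual_subst \<sigma> ^^ n) corner"
  obtain C where C: "C \<ge> 0" "\<And>f g a b. g \<in> dual_subst_face \<sigma> f \<Longrightarrow> a \<in> unit_face f \<Longrightarrow> b \<in> unit_face g \<Longrightarrow>
    norm (?M *v b - a) \<le> C"
    using dual_subst_face_near[OF inv] by blast
  have lin: "linear ?\<pi>" by (rule contracting_projection(1)[OF uv])
  define B where "B = onorm ?\<pi>"
  have B: "norm (?\<pi> w) \<le> B * norm w" "B \<ge> 0" for w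
    unfolding B_def using lin by (auto intro: onorm onorm_pos_le simp: linear_conv_bounded_linear)
  have comm: "?M *v ?\<pi> x = ?\<pi> (?M *v x)" for x
  proof -
    have "(?M *v x) \<bullet> v = \<beta> * (x \<bullet> v)"
      using dot_lmul_matrix[of v ?M x] v by (simp add: inner_commute scalar_mult_eq_scaleR)
    then show ?thesis
      using u by (simp add: contracting_projection_def matrix_vector_mult_diff_distrib
          matrix_vector_mult_scaleR scalar_mult_eq_scaleR)
  qed
  have linM: "linear ((*v) ?M ^^ n)" for n
  proof (induction n)
    case (Suc n)
    show ?case unfolding funpow.simps by (intro linear_compose Suc matrix_vector_mul_linear)
  qed (auto intro: linearI)
  have near: "dist (((*v) ?M ^^ n) (?\<pi> a)) (((*v) ?M ^^ Suc n) (?\<pi> b)) \<le> K * B * C * r ^ n"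
    if "g \<in> dual_subst_face \<sigma> f" "a \<in> unit_face f" "b \<in> unit_face g" for f g a b n
  proof -
    have "((*v) ?M ^^ Suc n) (?\<pi> b) - ((*v) ?M ^^ n) (?\<pi> a) = ((*v) ?M ^^ n) (?\<pi> (?M *v b) - ?\<pi> a)"
      by (simp add: funpow_swap1 comm linear_diff[OF linM])
    also have "?\<pi> (?M *v b) - ?\<pi> a = ?\<pi> (?M *v b - a)" by (simp add: linear_diff[OF lin])
    finally have "dist (((*v) ?M ^^ n) (?\<pi> a)) (((*v) ?M ^^ Suc n) (?\<pi> b)) =
        norm (((*v) ?M ^^ n) (?\<pi> (?M *v b - a)))"
      by (metis dist_norm norm_minus_commute)
    also have "\<dots> \<le> K * r ^ n * norm (?\<pi> (?M *v b - a))"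
      using contracting_projection(2)[OF uv] by (intro decay) (simp add: contracting_plane_def)
    also have "\<dots> \<le> K * r ^ n * (B * C)"
    proof (rule mult_left_mono)
      have "B * norm (?M *v b - a) \<le> B * C" using C(2)[OF that] B(2) by (rule mult_left_mono)
      then show "norm (?\<pi> (?M *v b - a)) \<le> B * C" using B(1)[of "?M *v b - a"] by linarith
    qed (use \<open>0 \<le> K\<close> r in simp)
    finally show ?thesis by (simp add: mult_ac)
  qed
  have mem: "x \<in> rauzy_approx \<sigma> u v n \<longleftrightarrow> (\<exists>f\<in>?F n. \<exists>a\<in>unit_face f. x = ((*v) ?M ^^ n) (?\<pi> a))" for x n
    by (auto simp: rauzy_approx_def faces_union_def)
  have F: "g \<in> ?F (Suc n) \<longleftrightarrow> (\<exists>f\<in>?F n. g \<in> dual_subst_face \<sigma> f)" for g n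
    by (simp add: dual_subst_def)
  have pt: "\<exists>a. a \<in> unit_face f" for f using real_point_in_unit_face by (cases f) blast
  show ?thesis
  proof (rule that[of "K * B * C"])
    show "K * B * C \<ge> 0" using \<open>0 \<le> K\<close> B(2) C(1) by simp
    show "\<exists>y\<in>rauzy_approx \<sigma> u v (Suc n). dist x y \<le> K * B * C * r ^ n" if x: "x \<in> rauzy_approx \<sigma> u v n" for n x
    proof -
      obtain f a where f: "f \<in> ?F n" "a \<in> unit_face f" "x = ((*v) ?M ^^ n) (?\<pi> a)" using x mem by blast
      obtain g where g: "g \<in> dual_subst_face \<sigma> f" using ne by blast
      obtain b where b: "b \<in> unit_face g" using pt by blast
      have "((*v) ?M ^^ Suc n) (?\<pi> b) \<in> rauzy_approx \<sigma> u v (Suc n)"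
        unfolding mem using F f(1) g b by blast
      then show ?thesis using near[OF g f(2) b, of n] f(3) by blast
    qed
    show "\<exists>x\<in>rauzy_approx \<sigma> u v n. dist x y \<le> K * B * C * r ^ n" if y: "y \<in> rauzy_approx \<sigma> u v (Suc n)" for n y
    proof -
      obtain g b where g: "g \<in> ?F (Suc n)" "b \<in> unit_face g" "y = ((*v) ?M ^^ Suc n) (?\<pi> b)" using y mem by blast
      obtain f where f: "f \<in> ?F n" "g \<in> dual_subst_face \<sigma> f" using g(1) F by blast
      obtain a where a: "a \<in> unit_face f" using pt by blast
      have "((*v) ?M ^^ n) (?\<pi> a) \<in> rauzy_approx \<sigma> u v n"
        unfolding mem using f(1) a by blast
      then show ?thesis using near[OF f(2) a g(2), of n] g(3) by blast
    qed
  qed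
qed

lemma bounded_rauzy_approx_0:
  assumes "u \<bullet> v \<noteq> 0"
  shows "bounded (rauzy_approx \<sigma> u v 0)"
proof -
  have "bounded (unit_face f)" for f
  proof -
    obtain x i where f: "f = (x, i)" by (cases f)
    show ?thesis
      unfolding f using norm_unit_face_diff
      by (intro bounded_subset[OF bounded_cball[of "real_point x" 3]]) (auto simp: dist_norm norm_minus_commute)
  qed
  then have "bounded (faces_union corner)" by (simp add: faces_union_def corner_def)
  then show ?thesis
    using bounded_linear_image contracting_projection(1)[OF assms]
    by (auto simp: rauzy_approx_def linear_conv_bounded_linear)
qed

lemma rauzy_approx_subset_contracting_plane:
  assumes "u \<bullet> v \<noteq> 0" and v: "transpose (incidence_matrix \<sigma>) *v v = \<beta> *s v"
  shows "rauzy_approx \<sigma> u v n \<subseteq> contracting_plane v"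
proof -
  have "((*v) (incidence_matrix \<sigma>) ^^ n) w \<in> contracting_plane v" if "w \<in> contracting_plane v" for w
  proof (induction n)
    case (Suc n)
    then show ?case
      using dot_lmul_matrix[of v "incidence_matrix \<sigma>" "((*v) (incidence_matrix \<sigma>) ^^ n) w"] v
      by (simp add: contracting_plane_def inner_commute scalar_mult_eq_scaleR)
  qed (simp add: that)
  then show ?thesis
    using contracting_projection(2)[OF assms(1)] unfolding rauzy_approx_def by blast
qed

theorem theorem4p3:
  fixes ks :: "letter list" and \<sigma> :: "word \<Rightarrow> word" and \<beta> :: real and u v :: "real ^ letter"
  assumes "ks \<noteq> []"
    and "\<sigma> = arnoux_rauzy_product ks"
    and "pisot_irreducible \<sigma>"
    and "maximal_eigenvalue \<sigma> \<beta>"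
    and "eigenvector (incidence_matrix \<sigma>) \<beta> u"
    and "eigenvector (transpose (incidence_matrix \<sigma>)) \<beta> v" and "\<forall>i. v $ i > 0"
  shows "connected (rauzy_fractal \<sigma> u v)"
proof -
  let ?D = "rauzy_approx \<sigma> u v"
  have \<beta>: "pisot_number \<beta>" and irr: "irreducible (characteristic_poly (incidence_matrix \<sigma> :: rat ^ letter ^ letter))"
    using assms(3,4) maximal_eigenvalue_unique unfolding pisot_irreducible_def by blast+
  have root: "poly (characteristic_poly (incidence_matrix \<sigma>)) \<beta> = 0"
    using assms(5) by (rule eigenvector_imp_root)
  have u: "incidence_matrix \<sigma> *v u = \<beta> *s u" "u \<noteq> 0" and v: "transpose (incidence_matrix \<sigma>) *v v = \<beta> *s v"
    using assms(5,6) unfolding eigenvector_def by blast+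
  have pos: "\<And>i. v $ i > 0" using assms(7) by blast
  have uv: "u \<bullet> v \<noteq> 0"
    using no_eigenvector_orthogonal[OF irr v pos _ u(1)] u(2) \<beta> by (auto simp: pisot_number_def)
  obtain K r where K: "0 \<le> r" "r < 1" "0 \<le> K"
    "\<And>w n. w \<bullet> v = 0 \<Longrightarrow> norm (((*v) (incidence_matrix \<sigma>) ^^ n) w) \<le> K * r ^ n * norm w"
    by (rule contracting_plane_decay[OF irr \<beta> root v pos]) blast
  have inv: "invertible (incidence_matrix \<sigma> :: int ^ letter ^ letter)"
    unfolding assms(2) by (rule invertible_incidence_matrix_arnoux_rauzy_product)
  have ne: "dual_subst_face \<sigma> f \<noteq> {}" for f
    using dual_subst_arnoux_rauzy_product_nonempty[of "{f}" ks] by (simp add: assms(2) dual_subst_def)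
  obtain C where C: "C \<ge> 0" "\<And>n x. x \<in> ?D n \<Longrightarrow> \<exists>y\<in>?D (Suc n). dist x y \<le> C * r ^ n"
    "\<And>n y. y \<in> ?D (Suc n) \<Longrightarrow> \<exists>x\<in>?D n. dist x y \<le> C * r ^ n"
    using rauzy_approx_step[OF inv ne u(1) v uv K(3,4,1)] by blast
  have bdd: "bounded (?D n)" for n
  proof (induction n)
    case 0
    show ?case by (rule bounded_rauzy_approx_0[OF uv])
  next
    case (Suc n)
    then obtain c e where ce: "\<And>x. x \<in> ?D n \<Longrightarrow> dist c x \<le> e" unfolding bounded_def by blast
    have "dist c y \<le> e + C * r ^ n" if y: "y \<in> ?D (Suc n)" for y
    proof -
      obtain x where "x \<in> ?D n" "dist x y \<le> C * r ^ n" using C(3)[OF y] by blast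
      then show ?thesis using ce[of x] dist_triangle[of c y x] by linarith
    qed
    then show ?case unfolding bounded_def by blast
  qed
  have ne_D: "?D n \<noteq> {}" for n
  proof -
    obtain f where "f \<in> (dual_subst \<sigma> ^^ n) corner"
      using dual_subst_iterates_corner(2) unfolding assms(2) by blast
    then show ?thesis
      using real_point_in_unit_face[of "fst f" "snd f"] by (force simp: rauzy_approx_def faces_union_def)
  qed
  have closed: "closed (contracting_plane v)"
    unfolding contracting_plane_def by (intro closed_Collect_eq continuous_intros)
  have sm: "summable (\<lambda>n. C * r ^ n)" using K(1,2) by (intro summable_mult summable_geometric) simp
  obtain R where R: "compact R" "R \<noteq> {}" "R \<subseteq> contracting_plane v"
    "(\<lambda>n. hausdorff_distance (?D n) R) \<longlonglongrightarrow> 0"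
    using hausdorff_limit_exists[OF bdd ne_D rauzy_approx_subset_contracting_plane[OF uv v] closed sm _ C(2,3)]
      C(1) K(1) by auto
  have "rauzy_fractal \<sigma> u v = R"
    unfolding rauzy_fractal_def
  proof (rule the_equality)
    fix S assume "compact S \<and> S \<noteq> {} \<and> S \<subseteq> contracting_plane v \<and> (\<lambda>n. hausdorff_distance (?D n) S) \<longlonglongrightarrow> 0"
    then show "S = R"
      using hausdorff_limit_unique[OF bdd ne_D _ _ _ R(1,2,4)] by blast
  qed (use R in blast)
  moreover have "connected R"
    using connected_rauzy_approx[of ks u v] unfolding assms(2)[symmetric]
    by (intro hausdorff_limit_connected[OF R(4) bdd ne_D _ R(1,2)])
  ultimately show ?thesis by simp
qed

end
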